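(* Suppose (Ass1) and (Ass2)$_3$. Provided that the function $u_\Delta(t,x,y)$ has bounded partial derivatives in $y$ of orders 2 and 3 (with bounds uniform in $t$, $x$, $y$ and in $J$), it holds $$\mathrm{Var}\big[f(X_{\Delta,T})-M^{int,1}_{\Delta,T}\big]=\mathrm{Var}\big[f(X_{\Delta,T})-M^{ser,1}_{\Delta,T}\big]\lesssim\Delta,$$ i.e. there is a constant $c>0$ not depending on $J$ such that this variance is at most $c\Delta$ for all $J\in\mathbb{N}$.
   Context: **SDE and Euler scheme.** $T>0$; $(W_t)_{t\in[0,T]}$ is a standard $m$-dimensional Brownian motion on a filtered probability space $(\Omega,\mathcal{F},(\mathcal{F}_t),\mathbb{P})$; $\mu:\mathbb{R}^d\to\mathbb{R}^d$, $\sigma:\mathbb{R}^d\to\mathbb{R}^{d\times m}$ are globally Lipschitz; $x_0\in\mathbb{R}^d$. For $J\in\mathbb{N}$ put $\Delta=T/J$, $t_j=j\Delta$, $\Delta_jW=W_{t_j}-W_{t_{j-1}}$ (components $\Delta_jW^i$), $\Phi_\Delta(x,y)=x+\mu(x)\Delta+\sigma(x)y$, $X_{\Delta,0}=x_0$, $X_{\Delta,t_j}=\Phi_\Delta(X_{\Delta,t_{j-1}},\Delta_jW)$. $X_{t_j,x}(\Delta,t_l)$, $l\ge j$, is the Euler scheme started at time $t_j$ in $x$, evaluated at $t_l$. $f:\mathbb{R}^d\to\mathbb{R}$ is Borel. **The function $u_\Delta$.** $u_\Delta(T,x,0)=f(x)$ and, for $t\in[t_{j-1},t_j)$, $x\in\mathbb{R}^d$,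 $y\in\mathbb{R}^m$, $u_\Delta(t,x,y)=\mathbb{E}[u_\Delta(t_j,\Phi_\Delta(x,y+z\sqrt{t_j-t}),0)]$ with $z\sim\mathcal{N}(0_m,I_m)$ (backward recursion). **Assumptions.** For every $J$, $j\in\{1,\dots,J\}$, $x\in\mathbb{R}^d$: (Ass1) $f(X_{t_{j-1},x}(\Delta,T))\in L^1$; (Ass2)$_n$ $|\Delta_jW|^n\,\mathbb{E}[f(X_{t_{j-1},x}(\Delta,T))\mid\mathcal{F}_{t_j}]\in L^1$. **Control variates.** $M^{int,1}_{\Delta,T}=\sum_{j=1}^J\sum_{i=1}^m\frac{\partial u_\Delta(t_{j-1},X_{\Delta,t_{j-1}},0)}{\partial y_i}\Delta_jW^i$ and $M^{ser,1}_{\Delta,T}=\sum_{j=1}^J\sum_{i=1}^ma_{j,e_i}(X_{\Delta,t_{j-1}})\frac{\Delta_jW^i}{\sqrt\Delta}$, where $a_{j,e_i}(x)=\mathbb{E}\big[f(X_{\Delta,T})\frac{\Delta_jW^i}{\sqrt\Delta}\,\big|\,X_{\Delta,t_{j-1}}=x\big]$, the conditioning meaning (Markov property) that the scheme is started at time $t_{j-1}$ in $x$. *)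

theory Defs
  imports "HOL-Probability.Probability"
begin

text \<open>The centred normal distribution on \<open>\<real>\<^sup>m\<close> with covariance matrix \<open>v\<close> times the identity.\<close>

definition gaussian :: "real \<Rightarrow> (real ^ 'm) measure" where
  "gaussian v = density lborel (\<lambda>y. ennreal (\<Prod>i\<in>UNIV. normal_density 0 (sqrt v) (y $ i)))"

definition filtration_on :: "'a measure \<Rightarrow> real \<Rightarrow> (real \<Rightarrow> 'a measure) \<Rightarrow> bool" where
  "filtration_on M T F \<longleftrightarrow>
     (\<forall>t\<in>{0..T}. subalgebra M (F t)) \<and>
     (\<forall>s\<in>{0..T}. \<forall>t\<in>{0..T}. s \<le> t \<longrightarrow> sets (F s) \<subseteq> sets (F t))"

definition brownian_motion ::
  "'a measure \<Rightarrow> real \<Rightarrow> (real \<Rightarrow> 'a measure) \<Rightarrow> (real \<Rightarrow> 'a \<Rightarrow> real ^ 'm) \<Rightarrow> bool" where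
  "brownian_motion M T F W \<longleftrightarrow>
     (AE \<omega> in M. W 0 \<omega> = 0) \<and>
     (AE \<omega> in M. continuous_on {0..T} (\<lambda>t. W t \<omega>)) \<and>
     (\<forall>t\<in>{0..T}. W t \<in> F t \<rightarrow>\<^sub>M borel) \<and>
     (\<forall>s t. 0 \<le> s \<and> s < t \<and> t \<le> T \<longrightarrow>
        distr M borel (\<lambda>\<omega>. W t \<omega> - W s \<omega>) = gaussian (t - s) \<and>
        prob_space.indep_set M (sets (F s))
          {(\<lambda>\<omega>. W t \<omega> - W s \<omega>) -` A \<inter> space M | A. A \<in> sets borel})"

definition step :: "real \<Rightarrow> nat \<Rightarrow> real" where
  "step T J = T / real J"

definition grid :: "real \<Rightarrow> nat \<Rightarrow> nat \<Rightarrow> real" where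
  "grid T J j = real j * step T J"

definition incr ::
  "real \<Rightarrow> (real \<Rightarrow> 'a \<Rightarrow> real ^ 'm) \<Rightarrow> nat \<Rightarrow> nat \<Rightarrow> 'a \<Rightarrow> real ^ 'm" where
  "incr T W J j \<omega> = W (grid T J j) \<omega> - W (grid T J (j - 1)) \<omega>"

definition euler_map ::
  "(real ^ 'd \<Rightarrow> real ^ 'd) \<Rightarrow> (real ^ 'd \<Rightarrow> real ^ 'm ^ 'd) \<Rightarrow> real \<Rightarrow>
   real ^ 'd \<Rightarrow> real ^ 'm \<Rightarrow> real ^ 'd" where
  "euler_map \<mu> \<sigma> \<Delta> x y = x + \<Delta> *\<^sub>R \<mu> x + \<sigma> x *v y"

text \<open>\<open>euler T \<mu> \<sigma> W J j x l\<close> is the Euler scheme with \<open>J\<close> steps, started at the \<open>j\<close>-th grid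
  point in \<open>x\<close>, evaluated at the \<open>l\<close>-th grid point; it is constantly \<open>x\<close> for \<open>l \<le> j\<close>.\<close>

primrec euler ::
  "real \<Rightarrow> (real ^ 'd \<Rightarrow> real ^ 'd) \<Rightarrow> (real ^ 'd \<Rightarrow> real ^ 'm ^ 'd) \<Rightarrow>
   (real \<Rightarrow> 'a \<Rightarrow> real ^ 'm) \<Rightarrow> nat \<Rightarrow> nat \<Rightarrow> real ^ 'd \<Rightarrow> nat \<Rightarrow> 'a \<Rightarrow> real ^ 'd" where
  "euler T \<mu> \<sigma> W J j x 0 \<omega> = x"
| "euler T \<mu> \<sigma> W J j x (Suc l) \<omega> =
     (if Suc l \<le> j then x
      else euler_map \<mu> \<sigma> (step T J) (euler T \<mu> \<sigma> W J j x l \<omega>) (incr T W J (Suc l) \<omega>))"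

text \<open>\<open>u_back T \<mu> \<sigma> f J n x\<close> is the value of \<open>u\<^sub>\<Delta>(t, x, 0)\<close> at the grid point \<open>t\<close> that is
  \<open>n\<close> steps before \<open>T\<close>.  The two lemmas \<open>u_fun_terminal\<close> and \<open>u_fun_recursion\<close> below are the
  defining backward recursion of \<open>u\<^sub>\<Delta>\<close>.\<close>

primrec u_back ::
  "real \<Rightarrow> (real ^ 'd \<Rightarrow> real ^ 'd) \<Rightarrow> (real ^ 'd \<Rightarrow> real ^ 'm ^ 'd) \<Rightarrow> (real ^ 'd \<Rightarrow> real) \<Rightarrow>
   nat \<Rightarrow> nat \<Rightarrow> real ^ 'd \<Rightarrow> real" where
  "u_back T \<mu> \<sigma> f J 0 x = f x"
| "u_back T \<mu> \<sigma> f J (Suc n) x =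
     (\<integral>z. u_back T \<mu> \<sigma> f J n (euler_map \<mu> \<sigma> (step T J) x (sqrt (step T J) *\<^sub>R z)) \<partial>gaussian 1)"

definition u_fun ::
  "real \<Rightarrow> (real ^ 'd \<Rightarrow> real ^ 'd) \<Rightarrow> (real ^ 'd \<Rightarrow> real ^ 'm ^ 'd) \<Rightarrow> (real ^ 'd \<Rightarrow> real) \<Rightarrow>
   nat \<Rightarrow> real \<Rightarrow> real ^ 'd \<Rightarrow> real ^ 'm \<Rightarrow> real" where
  "u_fun T \<mu> \<sigma> f J t x y =
     (if t = T then f x
      else let j = nat \<lfloor>t / step T J\<rfloor> + 1 in
        (\<integral>z. u_back T \<mu> \<sigma> f J (J - j)
           (euler_map \<mu> \<sigma> (step T J) x (y + sqrt (grid T J j - t) *\<^sub>R z)) \<partial>gaussian 1))"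

lemma u_fun_terminal: "u_fun T \<mu> \<sigma> f J T x 0 = f x"
  by (simp add: u_fun_def)

lemma u_fun_recursion:
  fixes \<sigma> :: "real ^ 'd \<Rightarrow> real ^ 'm ^ 'd" and y :: "real ^ 'm"
  assumes "T > 0" "1 \<le> j" "j \<le> J" "grid T J (j - 1) \<le> t" "t < grid T J j"
  shows "u_fun T \<mu> \<sigma> f J t x y =
    (\<integral>z. u_fun T \<mu> \<sigma> f J (grid T J j)
       (euler_map \<mu> \<sigma> (step T J) x (y + sqrt (grid T J j - t) *\<^sub>R z)) (0 :: real ^ 'm) \<partial>gaussian 1)"
proof -
  have J: "J > 0" and D: "step T J > 0"
    using assms by (auto simp: step_def)
  have gridJ: "grid T J J = T"
    using J by (simp add: grid_def step_def)
  have grid_le: "grid T J j \<le> T"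
    using assms J by (simp add: grid_def step_def field_simps)
  have fl: "nat \<lfloor>t / step T J\<rfloor> + 1 = j"
  proof -
    have "real (j - 1) \<le> t / step T J" "t / step T J < real (j - 1) + 1"
      using assms D by (auto simp: grid_def field_simps of_nat_diff)
    then have "\<lfloor>t / step T J\<rfloor> = int (j - 1)"
      by (intro floor_unique) auto
    then show ?thesis using assms by simp
  qed
  have at_grid: "u_fun T \<mu> \<sigma> f J (grid T J j) x' (0 :: real ^ 'm) = u_back T \<mu> \<sigma> f J (J - j) x'" for x'
  proof (cases "j = J")
    case True
    then show ?thesis by (simp add: u_fun_def gridJ)
  next
    case False
    then obtain n where n: "J - j = Suc n" "J - Suc j = n"
      using assms by (metis Suc_diff_Suc le_neq_implies_less)
    have "grid T J j \<noteq> T"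
      using False J assms by (simp add: grid_def step_def field_simps)
    moreover have "nat \<lfloor>grid T J j / step T J\<rfloor> + 1 = Suc j"
      using D by (simp add: grid_def)
    moreover have "grid T J (Suc j) - grid T J j = step T J"
      by (simp add: grid_def algebra_simps)
    ultimately show ?thesis
      by (simp only: u_fun_def n Let_def if_False u_back.simps) simp
  qed
  have "t \<noteq> T" using assms grid_le by simp
  then show ?thesis
    by (simp only: at_grid) (simp only: u_fun_def fl Let_def if_False)
qed

definition partial_differentiable :: "'m \<Rightarrow> (real ^ 'm \<Rightarrow> real) \<Rightarrow> real ^ 'm \<Rightarrow> bool" where
  "partial_differentiable i h y \<longleftrightarrow> (\<lambda>s. h (y + s *\<^sub>R axis i 1)) differentiable (at 0)"

definition partial_deriv :: "'m \<Rightarrow> (real ^ 'm \<Rightarrow> real) \<Rightarrow> real ^ 'm \<Rightarrow> real" where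
  "partial_deriv i h y = deriv (\<lambda>s. h (y + s *\<^sub>R axis i 1)) 0"

text \<open>All partial derivatives of \<open>u\<^sub>\<Delta>\<close> in \<open>y\<close> up to order 3 exist, and those of orders 2 and 3
  are bounded uniformly in \<open>J\<close>, \<open>t\<close>, \<open>x\<close> and \<open>y\<close>.  At \<open>t = T\<close> only \<open>y = 0\<close> is meaningful.\<close>

definition bounded_y_derivs ::
  "real \<Rightarrow> (real ^ 'd \<Rightarrow> real ^ 'd) \<Rightarrow> (real ^ 'd \<Rightarrow> real ^ 'm ^ 'd) \<Rightarrow> (real ^ 'd \<Rightarrow> real) \<Rightarrow> bool" where
  "bounded_y_derivs T \<mu> \<sigma> f \<longleftrightarrow>
     (\<exists>B. \<forall>J\<ge>1. \<forall>t\<in>{0..<T}. \<forall>x y i k l.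
        let h = u_fun T \<mu> \<sigma> f J t x in
          partial_differentiable i h y \<and>
          partial_differentiable k (partial_deriv i h) y \<and>
          partial_differentiable l (partial_deriv k (partial_deriv i h)) y \<and>
          \<bar>partial_deriv k (partial_deriv i h) y\<bar> \<le> B \<and>
          \<bar>partial_deriv l (partial_deriv k (partial_deriv i h)) y\<bar> \<le> B)"

definition Ass1 ::
  "'a measure \<Rightarrow> real \<Rightarrow> (real ^ 'd \<Rightarrow> real ^ 'd) \<Rightarrow> (real ^ 'd \<Rightarrow> real ^ 'm ^ 'd) \<Rightarrow>
   (real \<Rightarrow> 'a \<Rightarrow> real ^ 'm) \<Rightarrow> (real ^ 'd \<Rightarrow> real) \<Rightarrow> bool" where
  "Ass1 M T \<mu> \<sigma> W f \<longleftrightarrow>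
     (\<forall>J\<ge>1. \<forall>j\<in>{1..J}. \<forall>x. integrable M (\<lambda>\<omega>. f (euler T \<mu> \<sigma> W J (j - 1) x J \<omega>)))"

definition Ass2 ::
  "nat \<Rightarrow> 'a measure \<Rightarrow> (real \<Rightarrow> 'a measure) \<Rightarrow> real \<Rightarrow> (real ^ 'd \<Rightarrow> real ^ 'd) \<Rightarrow>
   (real ^ 'd \<Rightarrow> real ^ 'm ^ 'd) \<Rightarrow> (real \<Rightarrow> 'a \<Rightarrow> real ^ 'm) \<Rightarrow> (real ^ 'd \<Rightarrow> real) \<Rightarrow> bool" where
  "Ass2 n M F T \<mu> \<sigma> W f \<longleftrightarrow>
     (\<forall>J\<ge>1. \<forall>j\<in>{1..J}. \<forall>x. integrable M (\<lambda>\<omega>.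
        norm (incr T W J j \<omega>) ^ n *
        real_cond_exp M (F (grid T J j)) (\<lambda>\<omega>'. f (euler T \<mu> \<sigma> W J (j - 1) x J \<omega>')) \<omega>))"

definition M_int1 ::
  "real \<Rightarrow> (real ^ 'd \<Rightarrow> real ^ 'd) \<Rightarrow> (real ^ 'd \<Rightarrow> real ^ 'm ^ 'd) \<Rightarrow>
   (real \<Rightarrow> 'a \<Rightarrow> real ^ 'm) \<Rightarrow> (real ^ 'd \<Rightarrow> real) \<Rightarrow> real ^ 'd \<Rightarrow> nat \<Rightarrow> 'a \<Rightarrow> real" where
  "M_int1 T \<mu> \<sigma> W f x0 J \<omega> =
     (\<Sum>j=1..J. \<Sum>i\<in>UNIV.
        partial_deriv i (u_fun T \<mu> \<sigma> f J (grid T J (j - 1)) (euler T \<mu> \<sigma> W J 0 x0 (j - 1) \<omega>)) 0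
        * incr T W J j \<omega> $ i)"

text \<open>The coefficient \<open>a\<^sub>j\<^sub>,\<^sub>e\<^sub>i(x)\<close> is the expectation of \<open>\<xi> = f(X) \<Delta>\<^sub>jW\<^sup>i / \<surd>\<Delta>\<close>, where \<open>X\<close> is the
  terminal value of the scheme started at grid point \<open>j - 1\<close> in \<open>x\<close>.  \<open>Ass1\<close> and \<open>Ass2\<close> do not
  make \<open>\<xi>\<close> itself integrable; they make its conditional expectation given \<open>F\<close> at grid point \<open>j\<close>,
  i.e. \<open>\<Delta>\<^sub>jW\<^sup>i / \<surd>\<Delta>\<close> times that of \<open>f(X)\<close>, integrable.  The expectation is therefore taken
  through this conditional expectation, and the default value 0 of the Bochner integral never
  enters.  Whenever \<open>\<xi>\<close> is integrable this is the plain expectation of \<open>\<xi>\<close>, by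
  \<open>a_coeff_eq_expectation\<close>.\<close>

definition a_coeff ::
  "'a measure \<Rightarrow> (real \<Rightarrow> 'a measure) \<Rightarrow> real \<Rightarrow> (real ^ 'd \<Rightarrow> real ^ 'd) \<Rightarrow>
   (real ^ 'd \<Rightarrow> real ^ 'm ^ 'd) \<Rightarrow> (real \<Rightarrow> 'a \<Rightarrow> real ^ 'm) \<Rightarrow> (real ^ 'd \<Rightarrow> real) \<Rightarrow>
   nat \<Rightarrow> nat \<Rightarrow> 'm \<Rightarrow> real ^ 'd \<Rightarrow> real" where
  "a_coeff M F T \<mu> \<sigma> W f J j i x =
     (\<integral>\<omega>. real_cond_exp M (F (grid T J j))
        (\<lambda>\<omega>'. f (euler T \<mu> \<sigma> W J (j - 1) x J \<omega>') * (incr T W J j \<omega>' $ i / sqrt (step T J))) \<omega> \<partial>M)"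

lemma a_coeff_eq_expectation:
  assumes "prob_space M" "filtration_on M T F" "T > 0" "1 \<le> j" "j \<le> J"
    and "integrable M (\<lambda>\<omega>. f (euler T \<mu> \<sigma> W J (j - 1) x J \<omega>) * (incr T W J j \<omega> $ i / sqrt (step T J)))"
  shows "a_coeff M F T \<mu> \<sigma> W f J j i x =
    (\<integral>\<omega>. f (euler T \<mu> \<sigma> W J (j - 1) x J \<omega>) * (incr T W J j \<omega> $ i / sqrt (step T J)) \<partial>M)"
proof -
  interpret prob_space M by fact
  have "grid T J j \<in> {0..T}"
    using assms by (auto simp: grid_def step_def field_simps)
  then have "subalgebra M (F (grid T J j))"
    using assms by (auto simp: filtration_on_def)
  then interpret finite_measure_subalgebra M "F (grid T J j)"
    by unfold_locales
  show ?thesis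
    unfolding a_coeff_def using assms(6) by (rule real_cond_exp_int(2))
qed

definition M_ser1 ::
  "'a measure \<Rightarrow> (real \<Rightarrow> 'a measure) \<Rightarrow> real \<Rightarrow> (real ^ 'd \<Rightarrow> real ^ 'd) \<Rightarrow>
   (real ^ 'd \<Rightarrow> real ^ 'm ^ 'd) \<Rightarrow> (real \<Rightarrow> 'a \<Rightarrow> real ^ 'm) \<Rightarrow> (real ^ 'd \<Rightarrow> real) \<Rightarrow>
   real ^ 'd \<Rightarrow> nat \<Rightarrow> 'a \<Rightarrow> real" where
  "M_ser1 M F T \<mu> \<sigma> W f x0 J \<omega> =
     (\<Sum>j=1..J. \<Sum>i\<in>UNIV.
        a_coeff M F T \<mu> \<sigma> W f J j i (euler T \<mu> \<sigma> W J 0 x0 (j - 1) \<omega>)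
        * (incr T W J j \<omega> $ i / sqrt (step T J)))"

end

theory Submission
  imports Defs
begin

text \<open>
  Write \<open>h(w) = u\<^sub>\<Delta>(t\<^sub>j, \<Phi>\<^sub>\<Delta>(x, w), 0)\<close> for the value after the \<open>j\<close>-th Euler step from \<open>x\<close> with
  Brownian increment \<open>w\<close>.  On \<open>[t\<^sub>j\<^sub>-\<^sub>1, t\<^sub>j)\<close> the function \<open>u\<^sub>\<Delta>(t, x, \<cdot>)\<close> is the heat flow of \<open>h\<close> at
  time \<open>t\<^sub>j - t\<close>.  Since \<open>u\<^sub>\<Delta>\<close> along the scheme is the martingale \<open>E[f(X\<^sub>\<Delta>\<^sub>,\<^sub>T) | F\<^sub>t\<^sub>j]\<close>, telescoping
  (\<open>M_int1_decomposition\<close>) gives \<open>f(X\<^sub>\<Delta>\<^sub>,\<^sub>T) - M\<^sup>i\<^sup>n\<^sup>t = u\<^sub>\<Delta>(0, x\<^sub>0, 0) + \<Sigma>\<^sub>j R\<^sub>j\<close>, where \<open>R\<^sub>j\<close> is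
  \<open>h(\<Delta>\<^sub>jW)\<close> minus its mean minus the linear term with gradient \<open>\<nabla>u\<^sub>\<Delta>(t\<^sub>j\<^sub>-\<^sub>1, x, 0)\<close>, taken
  in \<open>y\<close>, at the position \<open>x\<close> of the scheme at time \<open>t\<^sub>j\<^sub>-\<^sub>1\<close>.

  By Gaussian integration by parts (\<open>gaussian_stein\<close>) that gradient is
  \<open>E[h(\<Delta>\<^sub>jW) \<Delta>\<^sub>jW] / \<Delta>\<close>.  Two consequences follow.  First, it equals \<open>a\<^sub>j\<^sub>,\<^sub>e\<^sub>i(x) / \<surd>\<Delta>\<close>
  (\<open>a_coeff_gradient\<close>), so the two control variates are the same random variable.  Second, \<open>R\<^sub>j\<close> is
  the residual of the orthogonal projection of \<open>h\<close> onto the affine functions in \<open>L\<^sup>2\<close> of the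
  Gaussian law with variance \<open>\<Delta>\<close>; hence it is centred and has second moment at most
  \<open>E[(h(\<Delta>\<^sub>jW) - \<ell>(\<Delta>\<^sub>jW))\<^sup>2]\<close> for every affine \<open>\<ell>\<close> (\<open>gaussian_affine_residual\<close>).

  If the second derivatives of \<open>h\<close> are bounded by \<open>B\<close>, the Taylor polynomial \<open>\<ell>\<close> at \<open>0\<close> satisfies
  \<open>|h(w) - \<ell>(w)| \<le> B |w|\<^sub>1\<^sup>2\<close>, with \<open>|w|\<^sub>1\<close> the sum of the absolute values of the components, so
  that \<open>E[R\<^sub>j\<^sup>2] \<le> C \<Delta>\<^sup>2\<close>.  The function \<open>h\<close> itself is merely Borel (in the last step it is \<open>f\<close>
  composed with an affine map); the bounds are known only for its heat flow at positive times.  They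
  survive the limit: the heat flow converges to \<open>h\<close> almost everywhere along a sequence of times
  tending to \<open>0\<close> (\<open>heat_tendsto_AE\<close>), and the affine Taylor polynomials have a convergent
  subsequence, which yields the same inequality for almost every \<open>w\<close> (\<open>taylor_bound_AE\<close>).  In
  particular \<open>h\<close> grows at most quadratically, which makes it square integrable.

  Finally the \<open>R\<^sub>j\<close> are martingale differences, so the second moment of their sum is at most
  \<open>J \<sdot> C \<Delta>\<^sup>2 = C T \<Delta>\<close> (\<open>residual_sum_bound\<close>).
\<close>

section \<open>Centred isotropic Gaussian measures\<close>

lemma prod_Basis_vec:
  fixes g :: "real ^ 'm \<Rightarrow> 'b::comm_monoid_mult"
  shows "(\<Prod>b\<in>Basis. g b) = (\<Prod>i\<in>UNIV. g (axis i 1))"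
proof -
  have "Basis = range (\<lambda>i::'m. axis i (1::real))"
    by (auto simp: Basis_vec_def)
  moreover have "inj (\<lambda>i::'m. axis i (1::real))"
    by (auto simp: inj_on_def axis_eq_axis)
  ultimately show ?thesis
    by (metis (no_types, lifting) prod.reindex_cong)
qed

lemma nn_integral_lborel_vec_prod:
  fixes f :: "'m::finite \<Rightarrow> real \<Rightarrow> ennreal"
  assumes [measurable]: "\<And>i. f i \<in> borel_measurable borel"
  shows "(\<integral>\<^sup>+y. (\<Prod>i\<in>UNIV. f i ((y :: real ^ 'm) $ i)) \<partial>lborel) = (\<Prod>i\<in>UNIV. \<integral>\<^sup>+x. f i x \<partial>lborel)"
proof -
  \<comment> \<open>\<open>k\<close> recovers the index from a canonical basis vector.\<close>
  define k where "k b = (THE i. b = axis i (1::real))" for b :: "real ^ 'm"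
  have k: "k (axis i 1) = i" for i
    unfolding k_def by (rule the_equality) (auto simp: axis_eq_axis)
  have "(\<integral>\<^sup>+y. (\<Prod>b\<in>Basis. f (k b) ((y :: real ^ 'm) \<bullet> b)) \<partial>lborel) = (\<Prod>b\<in>Basis. \<integral>\<^sup>+x. f (k b) x \<partial>lborel)"
    by (rule nn_integral_lborel_prod) auto
  then show ?thesis
    by (simp add: prod_Basis_vec k inner_axis)
qed

lemma measurable_vec_nth [measurable]: "(\<lambda>y :: real ^ 'm. y $ i) \<in> borel_measurable borel"
  by (intro borel_measurable_continuous_onI continuous_intros)

lemma sets_gaussian [simp, measurable_cong]: "sets (gaussian v) = sets borel"
  by (simp add: gaussian_def)

lemma space_gaussian [simp]: "space (gaussian v) = UNIV"
  by (simp add: gaussian_def)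

abbreviation gaussian_density :: "real \<Rightarrow> real ^ 'm \<Rightarrow> real" where
  "gaussian_density v y \<equiv> \<Prod>i\<in>UNIV. normal_density 0 (sqrt v) (y $ i)"

lemma gaussian_density_nonneg: "0 \<le> gaussian_density v y"
  by (simp add: prod_nonneg)

lemma gaussian_density_pos: "v > 0 \<Longrightarrow> 0 < gaussian_density v y"
  by (intro prod_pos) (auto intro: normal_density_pos)

lemma nn_integral_gaussian:
  fixes k :: "real ^ 'm \<Rightarrow> ennreal"
  assumes [measurable]: "k \<in> borel_measurable borel"
  shows "(\<integral>\<^sup>+y. k y \<partial>gaussian v) = (\<integral>\<^sup>+y. ennreal (gaussian_density v y) * k y \<partial>lborel)"
  unfolding gaussian_def by (subst nn_integral_density) auto

text \<open>Independence of the coordinates; all moments below reduce to one dimension through it.\<close>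

lemma nn_integral_gaussian_prod:
  fixes f :: "'m::finite \<Rightarrow> real \<Rightarrow> ennreal"
  assumes [measurable]: "\<And>i. f i \<in> borel_measurable borel"
  shows "(\<integral>\<^sup>+y. (\<Prod>i\<in>UNIV. f i ((y :: real ^ 'm) $ i)) \<partial>gaussian v)
       = (\<Prod>i\<in>UNIV. \<integral>\<^sup>+x. ennreal (normal_density 0 (sqrt v) x) * f i x \<partial>lborel)"
proof -
  have "(\<integral>\<^sup>+y. (\<Prod>i\<in>UNIV. f i ((y :: real ^ 'm) $ i)) \<partial>gaussian v)
      = (\<integral>\<^sup>+y. (\<Prod>i\<in>UNIV. ennreal (normal_density 0 (sqrt v) (y $ i)) * f i (y $ i)) \<partial>(lborel :: (real^'m) measure))"
    by (subst nn_integral_gaussian) (auto simp: prod.distrib prod_ennreal)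
  also have "\<dots> = (\<Prod>i\<in>UNIV. \<integral>\<^sup>+x. ennreal (normal_density 0 (sqrt v) x) * f i x \<partial>lborel)"
    by (rule nn_integral_lborel_vec_prod) auto
  finally show ?thesis .
qed

lemma nn_integral_normal_density: "s > 0 \<Longrightarrow> (\<integral>\<^sup>+x. ennreal (normal_density m s x) \<partial>lborel) = 1"
  by (subst nn_integral_eq_integral) (auto simp: normal_density_nonneg)

lemma prob_space_gaussian:
  assumes "v > 0"
  shows "prob_space (gaussian v :: (real ^ 'm) measure)"
proof
  have "(\<integral>\<^sup>+y. (\<Prod>i\<in>UNIV. (\<lambda>_ _. 1) i ((y :: real ^ 'm) $ i)) \<partial>gaussian v) = 1"
    using assms by (subst nn_integral_gaussian_prod) (auto simp: nn_integral_normal_density)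
  then show "emeasure (gaussian v :: (real ^ 'm) measure) (space (gaussian v)) = 1"
    by simp
qed

lemma nn_integral_gaussian_component:
  fixes i :: "'m::finite"
  assumes [measurable]: "g \<in> borel_measurable borel" and v: "v > 0"
  shows "(\<integral>\<^sup>+y. g ((y :: real ^ 'm) $ i) \<partial>gaussian v) = (\<integral>\<^sup>+x. ennreal (normal_density 0 (sqrt v) x) * g x \<partial>lborel)"
proof -
  define f where "f k = (if k = i then g else (\<lambda>_. 1))" for k
  have [measurable]: "f k \<in> borel_measurable borel" for k
    by (simp add: f_def)
  have "(\<Prod>k\<in>UNIV. f k (y k)) = g (y i)" for y
    by (subst prod.remove[of _ i]) (auto simp: f_def intro!: prod.neutral)
  moreover have "(\<Prod>k\<in>UNIV. \<integral>\<^sup>+x. ennreal (normal_density 0 (sqrt v) x) * f k x \<partial>lborel)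
    = (\<integral>\<^sup>+x. ennreal (normal_density 0 (sqrt v) x) * g x \<partial>lborel)"
    using v by (subst prod.remove[of _ i]) (auto simp: f_def nn_integral_normal_density intro!: prod.neutral)
  ultimately show ?thesis
    using nn_integral_gaussian_prod[of f v] by simp
qed

lemma distr_gaussian_component:
  fixes i :: "'m::finite"
  assumes v: "v > 0"
  shows "distr (gaussian v) borel (\<lambda>y :: real ^ 'm. y $ i) = density lborel (\<lambda>x. ennreal (normal_density 0 (sqrt v) x))"
proof (rule measure_eqI)
  fix A assume "A \<in> sets (distr (gaussian v) borel (\<lambda>y :: real ^ 'm. y $ i))"
  then have A [measurable]: "A \<in> sets borel" by simp
  show "emeasure (distr (gaussian v) borel (\<lambda>y :: real ^ 'm. y $ i)) A = 
        emeasure (density lborel (\<lambda>x. ennreal (normal_density 0 (sqrt v) x))) A"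
    using nn_integral_gaussian_component[of "indicator A" v i] v
    by (simp add: emeasure_density nn_integral_distr del: nn_integral_indicator flip: nn_integral_indicator[of _ "distr _ _ _"])
qed simp

lemma has_bochner_integral_gaussian_component:
  fixes i :: "'m::finite" and g :: "real \<Rightarrow> real"
  assumes v: "v > 0" and [measurable]: "g \<in> borel_measurable borel"
    and "has_bochner_integral lborel (\<lambda>x. normal_density 0 (sqrt v) x * g x) I"
  shows "has_bochner_integral (gaussian v) (\<lambda>y :: real ^ 'm. g (y $ i)) I"
proof -
  have "has_bochner_integral (density lborel (\<lambda>x. ennreal (normal_density 0 (sqrt v) x))) g I"
    using assms by (intro has_bochner_integral_density) auto
  then show ?thesis
    by (subst (asm) distr_gaussian_component[OF v, symmetric, of i])
      (simp add: has_bochner_integral_iff integrable_distr_eq integral_distr)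
qed

lemma gaussian_mean:
  assumes "v > 0"
  shows "has_bochner_integral (gaussian v) (\<lambda>y :: real ^ 'm. y $ i) 0"
  using assms normal_moment_odd[of "sqrt v" 0 0]
  by (intro has_bochner_integral_gaussian_component[where g = "\<lambda>x. x"]) auto

lemma gaussian_second_moment:
  assumes "v > 0"
  shows "has_bochner_integral (gaussian v) (\<lambda>y :: real ^ 'm. (y $ i)\<^sup>2) v"
  using assms normal_moment_even[of "sqrt v" 0 1]
  by (intro has_bochner_integral_gaussian_component[where g = "\<lambda>x. x\<^sup>2"]) (auto simp: numeral_2_eq_2)

lemma integrable_gaussian_power4:
  assumes "v > 0"
  shows "integrable (gaussian v) (\<lambda>y :: real ^ 'm. (y $ i) ^ 4)"
proof -
  have "has_bochner_integral (gaussian v) (\<lambda>y :: real ^ 'm. (y $ i)^4) (fact 4 / ((2 / v)^2 * fact 2))"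
    using assms normal_moment_even[of "sqrt v" 0 2]
    by (intro has_bochner_integral_gaussian_component[where g = "\<lambda>x. x^4"]) auto
  then show ?thesis ..
qed

text \<open>Completing the square turns the tilted density into a multiple of a shifted normal density.\<close>

lemma integrable_gaussian_exp:
  assumes v: "v > 0"
  shows "integrable (gaussian v) (\<lambda>y :: real ^ 'm. exp (c * y $ i))"
proof -
  have "normal_density 0 (sqrt v) x * exp (c * x) = exp (c\<^sup>2 * v / 2) * normal_density (c * v) (sqrt v) x" for x
  proof -
    have "- x\<^sup>2 / (2 * v) + c * x = c\<^sup>2 * v / 2 + - (x - c * v)\<^sup>2 / (2 * v)"
      using v by (simp add: field_simps power2_eq_square)
    then have "exp (- x\<^sup>2 / (2 * v)) * exp (c * x) = exp (c\<^sup>2 * v / 2) * exp (- (x - c * v)\<^sup>2 / (2 * v))"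
      by (simp only: flip: exp_add)
    then show ?thesis
      using v by (simp add: normal_density_def)
  qed
  moreover have "integrable lborel (\<lambda>x. exp (c\<^sup>2 * v / 2) * normal_density (c * v) (sqrt v) x)"
    using v by auto
  ultimately have "integrable lborel (\<lambda>x. normal_density 0 (sqrt v) x * exp (c * x))"
    by simp
  then have "has_bochner_integral (gaussian v) (\<lambda>y :: real ^ 'm. exp (c * y $ i)) (\<integral>x. normal_density 0 (sqrt v) x * exp (c * x) \<partial>lborel)"
    using v by (intro has_bochner_integral_gaussian_component[where g = "\<lambda>x. exp (c * x)"])
      (auto simp: has_bochner_integral_iff)
  then show ?thesis ..
qed

text \<open>The factors \<open>c\<^sub>i\<close> may differ in sign, so this covers both scalings and reflections in a
  coordinate hyperplane.\<close>

lemma distr_gaussian_diagonal: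
  fixes c :: "'m::finite \<Rightarrow> real"
  assumes v: "v > 0" and s: "s > 0" and c: "\<And>i. \<bar>c i\<bar> = s"
  shows "distr (gaussian v) borel (\<lambda>y :: real ^ 'm. \<chi> i. c i * y $ i) = gaussian (s\<^sup>2 * v)"
proof (rule measure_eqI)
  let ?T = "\<lambda>y :: real ^ 'm. \<chi> i. c i * y $ i"
  have c0: "c i \<noteq> 0" for i using c[of i] s by auto
  have T: "?T \<in> borel \<rightarrow>\<^sub>M borel"
    by (intro borel_measurable_continuous_onI continuous_intros)
  note [measurable] = T
  define k where "k b = (THE i. b = axis i (1::real))" for b :: "real ^ 'm"
  have k: "k (axis i 1) = i" for i
    unfolding k_def by (rule the_equality) (auto simp: axis_eq_axis)
  have sum_Basis: "(\<Sum>b\<in>Basis. g b) = (\<Sum>i\<in>UNIV. g (axis i 1))" for g :: "real ^ 'm \<Rightarrow> real ^ 'm"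
  proof -
    have "Basis = range (\<lambda>i::'m. axis i (1::real))"
      by (auto simp: Basis_vec_def)
    moreover have "inj (\<lambda>i::'m. axis i (1::real))"
      by (auto simp: inj_on_def axis_eq_axis)
    ultimately show ?thesis
      by (metis (no_types, lifting) sum.reindex_cong)
  qed
  have "?T y = 0 + (\<Sum>j\<in>Basis. (c (k j) * (y \<bullet> j)) *\<^sub>R j)" for y
    unfolding sum_Basis k inner_axis by (simp add: vec_eq_iff axis_def if_distrib sum.delta cong: if_cong)
  then have "?T = (\<lambda>y. 0 + (\<Sum>j\<in>Basis. (c (k j) * (y \<bullet> j)) *\<^sub>R j))" by blast
  moreover have "c (k b) \<noteq> 0" for b by (rule c0)
  ultimately have lb: "lborel = density (distr lborel borel ?T) (\<lambda>_. (\<Prod>j\<in>Basis. \<bar>c (k j)\<bar>))"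
    using lborel_affine_euclidean[of "\<lambda>b. c (k b)" "0 :: real ^ 'm"] by simp
  also have "(\<Prod>j\<in>Basis. \<bar>c (k j)\<bar>) = s ^ CARD('m)"
    by (simp add: prod_Basis_vec k c)
  finally have lb: "(lborel :: (real ^ 'm) measure) = density (distr lborel borel ?T) (\<lambda>_. s ^ CARD('m))" .
  fix A assume "A \<in> sets (distr (gaussian v) borel ?T)"
  then have A [measurable]: "A \<in> sets borel" by simp
  have nd: "normal_density 0 (sqrt (s\<^sup>2 * v)) (c i * x) * s = normal_density 0 (sqrt v) x" for i x
  proof -
    have "(c i)\<^sup>2 = s\<^sup>2" using c[of i] by (metis power2_abs)
    then show ?thesis
      using s v by (simp add: normal_density_def power_mult_distrib real_sqrt_mult field_simps)
  qed
  have dens: "gaussian_density (s\<^sup>2 * v) (?T y) * s ^ CARD('m) = gaussian_density v y" for y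
    by (simp add: nd flip: prod.distrib prod_constant)
  have dens': "ennreal (s ^ CARD('m)) * (ennreal (gaussian_density (s\<^sup>2 * v) (?T y)) * e) = ennreal (gaussian_density v y) * e" for y e
    using s by (simp only: dens[of y, symmetric] ennreal_mult gaussian_density_nonneg zero_le_power less_imp_le mult_ac)
  have "emeasure (gaussian (s\<^sup>2 * v)) A = (\<integral>\<^sup>+y. ennreal (gaussian_density (s\<^sup>2 * v) y) * indicator A y \<partial>lborel)"
    by (simp add: gaussian_def emeasure_density)
  also have "\<dots> = (\<integral>\<^sup>+y. ennreal (s ^ CARD('m)) * (ennreal (gaussian_density (s\<^sup>2 * v) (?T y)) * indicator A (?T y)) \<partial>lborel)"
    by (subst lb, subst nn_integral_density) (auto simp: nn_integral_distr)
  also have "\<dots> = (\<integral>\<^sup>+y. ennreal (gaussian_density v y) * indicator A (?T y) \<partial>lborel)"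
    by (simp only: dens')
  also have "\<dots> = emeasure (distr (gaussian v) borel ?T) A"
    by (simp add: nn_integral_gaussian nn_integral_distr flip: nn_integral_indicator)
  finally show "emeasure (distr (gaussian v) borel ?T) A = emeasure (gaussian (s\<^sup>2 * v)) A" by simp
qed simp

lemma distr_gaussian_scale:
  assumes v: "v > 0" and s: "s > 0"
  shows "distr (gaussian v) borel (\<lambda>y :: real ^ 'm. s *\<^sub>R y) = gaussian (s\<^sup>2 * v)"
proof -
  have "(\<lambda>y :: real ^ 'm. s *\<^sub>R y) = (\<lambda>y. \<chi> i. s * y $ i)"
    by (auto simp: vec_eq_iff)
  then show ?thesis
    using distr_gaussian_diagonal[of v s "\<lambda>_ :: 'm. s"] assms by simp
qed

lemma distr_gaussian_sqrt:
  "s > 0 \<Longrightarrow> distr (gaussian 1) borel (\<lambda>y :: real ^ 'm. sqrt s *\<^sub>R y) = gaussian s"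
  using distr_gaussian_scale[of 1 "sqrt s"] by simp

text \<open>The integrand changes sign under the reflection of the \<open>i\<close>-th coordinate, which preserves the
  measure.\<close>

lemma gaussian_cross_moment:
  fixes i k :: "'m::finite"
  assumes v: "v > 0" and ik: "i \<noteq> k"
  shows "has_bochner_integral (gaussian v) (\<lambda>y :: real ^ 'm. y $ i * y $ k) 0"
proof -
  let ?c = "\<lambda>l. if l = i then -1 else (1 :: real)"
  let ?T = "\<lambda>y :: real ^ 'm. \<chi> l. ?c l * y $ l"
  have T: "?T \<in> borel \<rightarrow>\<^sub>M borel"
    by (intro borel_measurable_continuous_onI continuous_intros)
  note [measurable] = T
  have int: "integrable (gaussian v) (\<lambda>y :: real ^ 'm. y $ i * y $ k)"
  proof (rule Bochner_Integration.integrable_bound)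
    show "integrable (gaussian v) (\<lambda>y :: real ^ 'm. (y $ i)\<^sup>2 + (y $ k)\<^sup>2)"
      using gaussian_second_moment[OF v, of i] gaussian_second_moment[OF v, of k]
      by (auto simp: has_bochner_integral_iff)
    show "AE y in gaussian v. norm ((y :: real ^ 'm) $ i * y $ k) \<le> norm ((y $ i)\<^sup>2 + (y $ k)\<^sup>2)"
    proof (rule AE_I2)
      fix y :: "real ^ 'm"
      have "2 * \<bar>y $ i * y $ k\<bar> \<le> (y $ i)\<^sup>2 + (y $ k)\<^sup>2"
        using sum_squares_bound[of "\<bar>y $ i\<bar>" "\<bar>y $ k\<bar>"] by (simp add: abs_mult)
      then show "norm (y $ i * y $ k) \<le> norm ((y $ i)\<^sup>2 + (y $ k)\<^sup>2)" by simp
    qed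
  qed simp
  have "distr (gaussian v) borel ?T = gaussian v"
    using distr_gaussian_diagonal[OF v, of 1 ?c] by simp
  then have "(\<integral>y. y $ i * y $ k \<partial>gaussian v) = (\<integral>y. y $ i * y $ k \<partial>(distr (gaussian v) borel ?T))"
    by simp
  also have "\<dots> = (\<integral>y. - (y $ i * y $ k) \<partial>(gaussian v :: (real ^ 'm) measure))"
    using ik by (subst integral_distr) auto
  finally show ?thesis
    using int by (simp add: has_bochner_integral_iff)
qed

lemma nn_integral_lborel_shift:
  fixes k :: "real ^ 'm \<Rightarrow> ennreal"
  assumes [measurable]: "k \<in> borel_measurable borel"
  shows "(\<integral>\<^sup>+w. k (y + w) \<partial>lborel) = (\<integral>\<^sup>+w. k w \<partial>lborel)"
proof -
  have "(\<integral>\<^sup>+w. k w \<partial>distr lborel borel ((+) y)) = (\<integral>\<^sup>+w. k (y + w) \<partial>lborel)"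
    by (subst nn_integral_distr) auto
  then show ?thesis by (simp add: lborel_distr_plus)
qed

text \<open>The semigroup property, in the form needed for nonnegative functions.\<close>

lemma nn_integral_gaussian_convolution:
  fixes k :: "real ^ 'm \<Rightarrow> ennreal"
  assumes [measurable]: "k \<in> borel_measurable borel" and a: "a > 0" and s: "s > 0"
  shows "(\<integral>\<^sup>+y. \<integral>\<^sup>+w. k (y + w) \<partial>gaussian s \<partial>gaussian a) = (\<integral>\<^sup>+u. k u \<partial>gaussian (a + s))"
proof -
  have conv: "(\<integral>\<^sup>+y. ennreal (gaussian_density s (u - y)) * ennreal (gaussian_density a y) \<partial>lborel)
      = ennreal (gaussian_density (a + s) u)" for u :: "real ^ 'm"
  proof -
    have "(\<integral>\<^sup>+x. ennreal (normal_density 0 (sqrt s) (t - x) * normal_density 0 (sqrt a) x) \<partial>lborel)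
        = ennreal (normal_density 0 (sqrt (a + s)) t)" for t
      using conv_normal_density_zero_mean[of "sqrt s" "sqrt a"] a s
      by (simp add: fun_eq_iff add.commute)
    then have "(\<integral>\<^sup>+y. (\<Prod>i\<in>UNIV. ennreal (normal_density 0 (sqrt s) (u $ i - y $ i) * normal_density 0 (sqrt a) (y $ i))) \<partial>(lborel :: (real^'m) measure))
      = ennreal (gaussian_density (a + s) u)"
      by (subst nn_integral_lborel_vec_prod
          [of "\<lambda>i x. ennreal (normal_density 0 (sqrt s) (u $ i - x) * normal_density 0 (sqrt a) x)"])
        (auto simp: prod_ennreal)
    then show ?thesis
      by (simp add: prod_ennreal prod.distrib ennreal_mult' gaussian_density_nonneg)
  qed
  have "(\<integral>\<^sup>+y. \<integral>\<^sup>+w. k (y + w) \<partial>gaussian s \<partial>gaussian a)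
     = (\<integral>\<^sup>+y. ennreal (gaussian_density a y) * (\<integral>\<^sup>+w. ennreal (gaussian_density s w) * k (y + w) \<partial>lborel) \<partial>lborel)"
    by (simp add: nn_integral_gaussian)
  also have "\<dots> = (\<integral>\<^sup>+y. ennreal (gaussian_density a y) * (\<integral>\<^sup>+u. ennreal (gaussian_density s (u - y)) * k u \<partial>lborel) \<partial>lborel)"
  proof (rule nn_integral_cong)
    fix y :: "real ^ 'm"
    have "(\<integral>\<^sup>+w. ennreal (gaussian_density s w) * k (y + w) \<partial>lborel) = (\<integral>\<^sup>+u. ennreal (gaussian_density s (u - y)) * k u \<partial>lborel)"
      using nn_integral_lborel_shift[of "\<lambda>u. ennreal (gaussian_density s (u - y)) * k u" y] by simp
    then show "ennreal (gaussian_density a y) * (\<integral>\<^sup>+w. ennreal (gaussian_density s w) * k (y + w) \<partial>lborel)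
      = ennreal (gaussian_density a y) * (\<integral>\<^sup>+u. ennreal (gaussian_density s (u - y)) * k u \<partial>lborel)"
      by (rule arg_cong)
  qed
  also have "\<dots> = (\<integral>\<^sup>+y. \<integral>\<^sup>+u. k u * (ennreal (gaussian_density s (u - y)) * ennreal (gaussian_density a y)) \<partial>lborel \<partial>lborel)"
    by (simp add: nn_integral_cmult[symmetric] mult_ac)
  also have "\<dots> = (\<integral>\<^sup>+u. \<integral>\<^sup>+y. k u * (ennreal (gaussian_density s (u - y)) * ennreal (gaussian_density a y)) \<partial>lborel \<partial>lborel)"
    by (rule lborel_pair.Fubini') simp
  also have "\<dots> = (\<integral>\<^sup>+u. k u * ennreal (gaussian_density (a + s) u) \<partial>lborel)"
    by (simp add: nn_integral_cmult conv del: vector_minus_component)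
  also have "\<dots> = (\<integral>\<^sup>+u. k u \<partial>gaussian (a + s))"
    by (simp add: nn_integral_gaussian mult.commute)
  finally show ?thesis .
qed

text \<open>The factor is the Cameron--Martin density of the shift by \<open>y\<close>.\<close>

lemma gaussian_density_shift:
  assumes v: "v > 0"
  shows "gaussian_density v (w - y) = gaussian_density v w * exp ((y \<bullet> w - y \<bullet> y / 2) / v)"
proof -
  have nd: "normal_density 0 (sqrt v) (x - t) = normal_density 0 (sqrt v) x * exp ((t * x - t * t / 2) / v)" for x t
  proof -
    have "- (x - t)\<^sup>2 / (2 * v) = - x\<^sup>2 / (2 * v) + (t * x - t * t / 2) / v"
      using v by (simp add: field_simps power2_eq_square)
    then have "exp (- (x - t)\<^sup>2 / (2 * v)) = exp (- x\<^sup>2 / (2 * v)) * exp ((t * x - t * t / 2) / v)"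
      by (simp only: flip: exp_add)
    then show ?thesis
      using v by (simp add: normal_density_def)
  qed
  have "(\<Prod>i\<in>UNIV. exp ((y $ i * w $ i - y $ i * y $ i / 2) / v)) = exp ((y \<bullet> w - y \<bullet> y / 2) / v)"
    by (simp add: inner_vec_def sum_divide_distrib sum_subtractf diff_divide_distrib flip: exp_sum)
  then show ?thesis
    by (simp add: nd prod.distrib)
qed

lemma integral_gaussian_shift:
  fixes h :: "real ^ 'm \<Rightarrow> real"
  assumes v: "v > 0" and [measurable]: "h \<in> borel_measurable borel"
  shows "(\<integral>w. h (y + w) \<partial>gaussian v) = (\<integral>w. exp ((y \<bullet> w - y \<bullet> y / 2) / v) * h w \<partial>gaussian v)"
proof -
  have "(\<integral>w. exp ((y \<bullet> w - y \<bullet> y / 2) / v) * h w \<partial>gaussian v) = (\<integral>w. gaussian_density v (w - y) * h w \<partial>lborel)"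
    unfolding gaussian_def
    by (subst integral_density) (auto simp: gaussian_density_nonneg gaussian_density_shift[OF v] mult.assoc simp del: vector_minus_component)
  also have "\<dots> = (\<integral>w. gaussian_density v (w - y) * h w \<partial>distr lborel borel ((+) y))"
    by (simp add: lborel_distr_plus)
  also have "\<dots> = (\<integral>w. gaussian_density v w * h (y + w) \<partial>lborel)"
    by (subst integral_distr) auto
  also have "\<dots> = (\<integral>w. h (y + w) \<partial>gaussian v)"
    unfolding gaussian_def by (subst integral_density) (auto simp: gaussian_density_nonneg)
  finally show ?thesis by simp
qed

lemma AE_gaussian_iff:
  assumes v: "v > 0"
  shows "(AE y in gaussian v. P y) \<longleftrightarrow> (AE y in (lborel :: (real ^ 'm) measure). P y)"
  unfolding gaussian_def
  by (subst AE_density) (auto simp: gaussian_density_pos[OF v])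

text \<open>Parametrised by the variance \<open>s\<close> of the Gaussian kernel, i.e. the flow of one half of the
  Laplacian at time \<open>s\<close>.\<close>

definition heat :: "real \<Rightarrow> (real ^ 'm \<Rightarrow> real) \<Rightarrow> real ^ 'm \<Rightarrow> real" where
  "heat s h y = (\<integral>z. h (y + sqrt s *\<^sub>R z) \<partial>gaussian 1)"

lemma heat_eq:
  fixes h :: "real ^ 'm \<Rightarrow> real"
  assumes s: "s > 0" and [measurable]: "h \<in> borel_measurable borel"
  shows "heat s h y = (\<integral>w. h (y + w) \<partial>gaussian s)"
  unfolding heat_def
  by (subst distr_gaussian_sqrt[OF s, symmetric], subst integral_distr) auto

section \<open>Taylor expansion from bounds on partial derivatives\<close>

lemma has_partial_deriv:
  assumes "partial_differentiable i g (y + t *\<^sub>R axis i 1)"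
  shows "((\<lambda>s. g (y + s *\<^sub>R axis i 1)) has_real_derivative partial_deriv i g (y + t *\<^sub>R axis i 1)) (at t)"
proof -
  let ?z = "y + t *\<^sub>R axis i (1::real)"
  have "((\<lambda>s. g (?z + s *\<^sub>R axis i 1)) has_real_derivative partial_deriv i g ?z) (at 0)"
    using assms by (simp add: partial_differentiable_def partial_deriv_def DERIV_deriv_iff_real_differentiable)
  moreover have "(\<lambda>s. g (?z + s *\<^sub>R axis i 1)) = (\<lambda>s. g (y + (t + s) *\<^sub>R axis i 1))"
    by (simp add: algebra_simps scaleR_add_left)
  ultimately have "((\<lambda>s. g (y + (t + s) *\<^sub>R axis i 1)) has_real_derivative partial_deriv i g ?z) (at 0)"
    by simp
  then show ?thesis
    using DERIV_at_within_shift[of "\<lambda>s. g (y + s *\<^sub>R axis i 1)" _ t 0 UNIV] by simp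
qed

lemma partial_deriv_bound_increment:
  assumes d: "\<And>y. partial_differentiable i g y" and B: "\<And>y. \<bar>partial_deriv i g y\<bar> \<le> B"
  shows "\<bar>g (y + t *\<^sub>R axis i 1) - g y\<bar> \<le> B * \<bar>t\<bar>"
  using field_differentiable_bound[of UNIV "\<lambda>s. g (y + s *\<^sub>R axis i 1)" "\<lambda>s. partial_deriv i g (y + s *\<^sub>R axis i 1)" B 0 t]
  using has_partial_deriv[OF d] B by simp

lemma second_order_increment:
  assumes d: "\<And>y. partial_differentiable i g y"
    and d2: "\<And>y. partial_differentiable i (partial_deriv i g) y"
    and B: "\<And>y. \<bar>partial_deriv i (partial_deriv i g) y\<bar> \<le> B"
  shows "\<bar>g (y + t *\<^sub>R axis i 1) - g y - partial_deriv i g y * t\<bar> \<le> B * t\<^sup>2"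
proof -
  let ?c = "partial_deriv i g y"
  have B0: "0 \<le> B" using B[of y] by linarith
  have "norm ((g (y + t *\<^sub>R axis i 1) - ?c * t) - (g (y + 0 *\<^sub>R axis i 1) - ?c * 0)) \<le> (B * \<bar>t\<bar>) * norm (t - 0)"
  proof (rule field_differentiable_bound[where S = "closed_segment 0 t"
        and f' = "\<lambda>s. partial_deriv i g (y + s *\<^sub>R axis i 1) - ?c"])
    fix s assume s: "s \<in> closed_segment 0 t"
    show "((\<lambda>s. g (y + s *\<^sub>R axis i 1) - ?c * s) has_real_derivative partial_deriv i g (y + s *\<^sub>R axis i 1) - ?c) (at s within closed_segment 0 t)"
      by (rule derivative_eq_intros has_field_derivative_at_within[OF has_partial_deriv[OF d]] refl | simp)+
    have "\<bar>partial_deriv i g (y + s *\<^sub>R axis i 1) - ?c\<bar> \<le> B * \<bar>s\<bar>"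
      by (rule partial_deriv_bound_increment[OF d2 B])
    also have "\<dots> \<le> B * \<bar>t\<bar>"
      using s B0 by (intro mult_left_mono) (auto simp: closed_segment_eq_real_ivl split: if_splits)
    finally show "norm (partial_deriv i g (y + s *\<^sub>R axis i 1) - ?c) \<le> B * \<bar>t\<bar>" by simp
  qed auto
  then show ?thesis
    by (simp add: power2_eq_square abs_mult algebra_simps flip: abs_mult)
qed

lemma partial_derivs_bound_increment:
  fixes y :: "real ^ 'm"
  assumes d: "\<And>i y. partial_differentiable i g y" and B: "\<And>i y. \<bar>partial_deriv i g y\<bar> \<le> B"
  shows "\<bar>g (\<Sum>i\<in>S. y $ i *\<^sub>R axis i 1) - g 0\<bar> \<le> B * (\<Sum>i\<in>S. \<bar>y $ i\<bar>)"
proof (induction S rule: infinite_finite_induct)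
  case (insert k S)
  let ?u = "\<Sum>i\<in>S. y $ i *\<^sub>R axis i (1::real)"
  have "\<bar>g (?u + y $ k *\<^sub>R axis k 1) - g ?u\<bar> \<le> B * \<bar>y $ k\<bar>"
    by (rule partial_deriv_bound_increment[OF d B])
  with insert show ?case
    by (simp add: add.commute algebra_simps)
qed auto

text \<open>Only existence and boundedness of iterated partial derivatives are available, not
  differentiability in the sense of Frechet.  Therefore \<open>0\<close> is joined to \<open>y\<close> by a path along the
  coordinate axes, adding one coordinate at a time.  The step in direction \<open>k\<close> costs
  \<open>B |y\<^sub>k|\<^sup>2\<close> for the pure second derivative, and \<open>B |y\<^sub>k|\<close> times the length of the path so far for
  replacing the \<open>k\<close>-th derivative at the current point by the one at \<open>0\<close>; the total is at most
  \<open>B\<close> times the squared length of the path.\<close>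

lemma first_order_expansion:
  fixes y :: "real ^ 'm"
  assumes d: "\<And>i y. partial_differentiable i g y"
    and d2: "\<And>i k y. partial_differentiable k (partial_deriv i g) y"
    and B: "\<And>i k y. \<bar>partial_deriv k (partial_deriv i g) y\<bar> \<le> B"
  shows "\<bar>g y - g 0 - (\<Sum>i\<in>UNIV. partial_deriv i g 0 * y $ i)\<bar> \<le> B * (\<Sum>i\<in>UNIV. \<bar>y $ i\<bar>)\<^sup>2"
proof -
  have B0: "0 \<le> B" using B[of undefined undefined 0] by linarith
  have "\<bar>g (\<Sum>i\<in>S. y $ i *\<^sub>R axis i 1) - g 0 - (\<Sum>i\<in>S. partial_deriv i g 0 * y $ i)\<bar> \<le> B * (\<Sum>i\<in>S. \<bar>y $ i\<bar>)\<^sup>2"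
    for S :: "'m set"
  proof (induction S rule: infinite_finite_induct)
    case (insert k S)
    let ?u = "\<Sum>i\<in>S. y $ i *\<^sub>R axis i (1::real)"
    let ?a = "\<Sum>i\<in>S. \<bar>y $ i\<bar>" and ?t = "y $ k"
    have a0: "0 \<le> ?a" by (simp add: sum_nonneg)
    have 1: "\<bar>g (?u + ?t *\<^sub>R axis k 1) - g ?u - partial_deriv k g ?u * ?t\<bar> \<le> B * ?t\<^sup>2"
      by (rule second_order_increment[OF d d2 B])
    have "\<bar>partial_deriv k g ?u - partial_deriv k g 0\<bar> \<le> B * ?a"
      by (rule partial_derivs_bound_increment[OF d2 B])
    then have "\<bar>(partial_deriv k g ?u - partial_deriv k g 0) * ?t\<bar> \<le> B * ?a * \<bar>?t\<bar>"
      unfolding abs_mult by (rule mult_right_mono) simp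
    then have 2: "\<bar>partial_deriv k g ?u * ?t - partial_deriv k g 0 * ?t\<bar> \<le> B * ?a * \<bar>?t\<bar>"
      by (simp add: algebra_simps)
    have "\<bar>g (?t *\<^sub>R axis k 1 + ?u) - g 0 - (partial_deriv k g 0 * ?t + (\<Sum>i\<in>S. partial_deriv i g 0 * y $ i))\<bar>
        \<le> B * ?t\<^sup>2 + B * ?a * \<bar>?t\<bar> + B * ?a\<^sup>2"
      using 1 2 insert.IH unfolding add.commute[of "?t *\<^sub>R axis k 1"] by linarith
    also have "\<dots> \<le> B * (\<bar>?t\<bar> + ?a)\<^sup>2"
      using a0 B0 by (simp add: power2_sum algebra_simps)
    finally show ?case
      using insert by simp
  qed auto
  from this[of UNIV] show ?thesis
    using basis_expansion[of y] by (simp add: scalar_mult_eq_scaleR)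
qed

section \<open>Convergence of the heat flow to its initial value\<close>

text \<open>Truncate \<open>h\<close> to a bounded function, and truncate at the same level a sequence of continuous
  functions that converges to \<open>h\<close> almost everywhere; both errors vanish by dominated convergence.\<close>

lemma continuous_approximation:
  fixes h :: "real ^ 'm \<Rightarrow> real"
  assumes v: "v > 0" and hm [measurable]: "h \<in> borel_measurable borel"
    and int: "integrable (gaussian v) h" and e: "\<epsilon> > 0"
  obtains g K where "continuous_on UNIV g" "\<And>y. \<bar>g y\<bar> \<le> K" "(\<integral>y. \<bar>h y - g y\<bar> \<partial>gaussian v) < \<epsilon>"
proof -
  interpret G: prob_space "gaussian v :: (real ^ 'm) measure"
    by (rule prob_space_gaussian[OF v])
  define clip where "clip K x = max (- K) (min K x)" for K x :: real
  have clip_cont: "continuous_on UNIV (clip K)" for K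
    unfolding clip_def by (intro continuous_intros)
  have [measurable]: "clip K \<in> borel_measurable borel" for K
    by (intro borel_measurable_continuous_onI clip_cont)
  have clip_bound: "\<bar>clip K x\<bar> \<le> K" if "K \<ge> 0" for K x
    using that by (auto simp: clip_def)
  have clip_le: "\<bar>clip K x\<bar> \<le> \<bar>x\<bar>" if "K \<ge> 0" for K x
    using that by (auto simp: clip_def)
  have "(\<lambda>n. \<integral>y. \<bar>h y - clip (real n) (h y)\<bar> \<partial>gaussian v) \<longlonglongrightarrow> (\<integral>y. 0 \<partial>(gaussian v :: (real ^ 'm) measure))"
  proof (rule integral_dominated_convergence[where w = "\<lambda>y. 2 * \<bar>h y\<bar>"])
    show "AE y in gaussian v. (\<lambda>n. \<bar>h y - clip (real n) (h y)\<bar>) \<longlonglongrightarrow> 0"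
    proof (rule AE_I2)
      fix y
      obtain N :: nat where N: "\<bar>h y\<bar> \<le> real N" using real_arch_simple by blast
      have "\<bar>h y - clip (real n) (h y)\<bar> = 0" if "n \<ge> N" for n
      proof -
        have "\<bar>h y\<bar> \<le> real n" using N that by linarith
        then show ?thesis by (auto simp: clip_def)
      qed
      then show "(\<lambda>n. \<bar>h y - clip (real n) (h y)\<bar>) \<longlonglongrightarrow> 0"
        by (intro tendsto_eventually) (auto simp: eventually_sequentially)
    qed
    show "AE y in gaussian v. norm \<bar>h y - clip (real n) (h y)\<bar> \<le> 2 * \<bar>h y\<bar>" for n
      using clip_le[of "real n"] by (intro AE_I2) (smt (verit) of_nat_0_le_iff real_norm_def)
  qed (use int in auto)
  then have "(\<lambda>n. \<integral>y. \<bar>h y - clip (real n) (h y)\<bar> \<partial>gaussian v) \<longlonglongrightarrow> 0" by simp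
  from order_tendstoD(2)[OF this, of "\<epsilon> / 2"] e
  obtain K where K: "(\<integral>y. \<bar>h y - clip (real K) (h y)\<bar> \<partial>gaussian v) < \<epsilon> / 2"
    by (auto simp: eventually_sequentially)
  have "h \<in> borel_measurable (lebesgue_on UNIV)"
    using measurable_completion[of h lborel borel] hm by simp
  then have "h measurable_on UNIV"
    by (subst measurable_on_iff_borel_measurable) auto
  then obtain N and g :: "nat \<Rightarrow> real ^ 'm \<Rightarrow> real"
    where N: "negligible N" and g: "\<And>n. continuous_on UNIV (g n)" and lim: "\<And>x. x \<notin> N \<Longrightarrow> (\<lambda>n. g n x) \<longlonglongrightarrow> h x"
    unfolding measurable_on_def by auto
  have [measurable]: "g n \<in> borel_measurable borel" for n
    by (intro borel_measurable_continuous_onI g)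
  have "AE y in lebesgue. y \<notin> N"
    using N by (intro AE_not_in) (simp add: negligible_iff_null_sets)
  then have "AE y in lborel. y \<notin> N"
    by (simp add: AE_completion_iff)
  then have AEN: "AE y in gaussian v. y \<notin> N"
    by (simp add: AE_gaussian_iff[OF v])
  have "(\<lambda>n. \<integral>y. \<bar>clip K (h y) - clip K (g n y)\<bar> \<partial>gaussian v) \<longlonglongrightarrow> (\<integral>y. 0 \<partial>(gaussian v :: (real ^ 'm) measure))"
  proof (rule integral_dominated_convergence[where w = "\<lambda>y. 2 * real K"])
    show "AE y in gaussian v. (\<lambda>n. \<bar>clip K (h y) - clip K (g n y)\<bar>) \<longlonglongrightarrow> 0"
      using AEN
    proof eventually_elim
      case (elim y)
      have "(\<lambda>n. clip K (g n y)) \<longlonglongrightarrow> clip K (h y)"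
        by (rule continuous_on_tendsto_compose[OF clip_cont lim[OF elim]]) auto
      then have "(\<lambda>n. \<bar>clip K (h y) - clip K (g n y)\<bar>) \<longlonglongrightarrow> \<bar>clip K (h y) - clip K (h y)\<bar>"
        by (intro tendsto_intros)
      then show ?case by simp
    qed
    show "AE y in gaussian v. norm \<bar>clip K (h y) - clip K (g n y)\<bar> \<le> 2 * real K" for n
      using clip_bound[of "real K"] by (intro AE_I2) (smt (verit) of_nat_0_le_iff real_norm_def)
  qed auto
  then have "(\<lambda>n. \<integral>y. \<bar>clip K (h y) - clip K (g n y)\<bar> \<partial>gaussian v) \<longlonglongrightarrow> 0" by simp
  from order_tendstoD(2)[OF this, of "\<epsilon> / 2"] e
  obtain n where n: "(\<integral>y. \<bar>clip K (h y) - clip K (g n y)\<bar> \<partial>gaussian v) < \<epsilon> / 2"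
    by (auto simp: eventually_sequentially)
  have bint: "integrable (gaussian v) (\<lambda>y. clip K (k y))" if [measurable]: "k \<in> borel_measurable borel" for k :: "real ^ 'm \<Rightarrow> real"
    by (rule G.integrable_const_bound[of _ "real K"]) (auto simp: clip_bound)
  have "(\<integral>y. \<bar>h y - clip K (g n y)\<bar> \<partial>gaussian v)
      \<le> (\<integral>y. \<bar>h y - clip K (h y)\<bar> + \<bar>clip K (h y) - clip K (g n y)\<bar> \<partial>gaussian v)"
    by (intro integral_mono Bochner_Integration.integrable_add integrable_abs Bochner_Integration.integrable_diff int bint) auto
  also have "\<dots> = (\<integral>y. \<bar>h y - clip K (h y)\<bar> \<partial>gaussian v) + (\<integral>y. \<bar>clip K (h y) - clip K (g n y)\<bar> \<partial>gaussian v)"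
    by (intro Bochner_Integration.integral_add integrable_abs Bochner_Integration.integrable_diff int bint) auto
  finally have "(\<integral>y. \<bar>h y - clip K (g n y)\<bar> \<partial>gaussian v) < \<epsilon>"
    using K n by linarith
  moreover have "continuous_on UNIV (\<lambda>y. clip K (g n y))"
    by (rule continuous_on_compose2[OF clip_cont g]) auto
  ultimately show ?thesis
    using that[of "\<lambda>y. clip K (g n y)" "real K"] clip_bound by simp
qed

lemma gaussian_density_comparison:
  fixes y :: "real ^ 'm"
  assumes v: "v > 0" and a: "v / 2 \<le> a" "a \<le> v"
  shows "gaussian_density a y \<le> sqrt 2 ^ CARD('m) * gaussian_density v y"
proof -
  have "normal_density 0 (sqrt a) x \<le> sqrt 2 * normal_density 0 (sqrt v) x" for x
  proof -
    have "1 / sqrt (2 * pi * a) \<le> sqrt 2 / sqrt (2 * pi * v)"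
    proof -
      have "sqrt (2 * pi * v) \<le> sqrt 2 * sqrt (2 * pi * a)"
        using a by (subst real_sqrt_mult[symmetric], intro real_sqrt_le_mono) auto
      then show ?thesis using v a by (simp add: field_simps)
    qed
    moreover have "exp (- x\<^sup>2 / (2 * a)) \<le> exp (- x\<^sup>2 / (2 * v))"
      using v a by (simp add: frac_le)
    ultimately have "1 / sqrt (2 * pi * a) * exp (- x\<^sup>2 / (2 * a)) \<le> sqrt 2 / sqrt (2 * pi * v) * exp (- x\<^sup>2 / (2 * v))"
      using v by (intro mult_mono) auto
    then show ?thesis using v a by (simp add: normal_density_def)
  qed
  then have "gaussian_density a y \<le> (\<Prod>i\<in>UNIV. sqrt 2 * normal_density 0 (sqrt v) (y $ i))"
    by (intro prod_mono) auto
  then show ?thesis by (simp add: prod.distrib)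
qed

text \<open>On the range \<open>[v/2, v]\<close> of variances, smallness in \<open>L\<^sup>1\<close> of the Gaussian measure with the
  largest variance controls all the others.\<close>

lemma nn_integral_gaussian_comparison:
  fixes k :: "real ^ 'm \<Rightarrow> ennreal"
  assumes [measurable]: "k \<in> borel_measurable borel" and v: "v > 0" and a: "v / 2 \<le> a" "a \<le> v"
  shows "(\<integral>\<^sup>+y. k y \<partial>gaussian a) \<le> ennreal (sqrt 2 ^ CARD('m)) * (\<integral>\<^sup>+y. k y \<partial>gaussian v)"
proof -
  have "(\<integral>\<^sup>+y. k y \<partial>gaussian a) = (\<integral>\<^sup>+y. ennreal (gaussian_density a y) * k y \<partial>lborel)"
    by (simp add: nn_integral_gaussian)
  also have "\<dots> \<le> (\<integral>\<^sup>+y. ennreal (sqrt 2 ^ CARD('m)) * (ennreal (gaussian_density v y) * k y) \<partial>lborel)"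
    by (intro nn_integral_mono)
      (simp add: mult.assoc[symmetric] gaussian_density_nonneg ennreal_leI mult_right_mono
        gaussian_density_comparison[OF v a] flip: ennreal_mult)
  also have "\<dots> = ennreal (sqrt 2 ^ CARD('m)) * (\<integral>\<^sup>+y. k y \<partial>gaussian v)"
    by (simp add: nn_integral_cmult nn_integral_gaussian)
  finally show ?thesis .
qed

text \<open>Almost everywhere convergence comes from convergence in \<open>L\<^sup>1\<close> of the Gaussian measure with
  variance \<open>v/2\<close>.  For bounded continuous functions this is dominated convergence.  The general case
  follows by approximation, because for \<open>s \<le> v/2\<close> the shift by an independent Gaussian vector with
  variance \<open>s\<close> gives total variance in \<open>[v/2, v]\<close>, so that the approximation error before and after
  the shift is controlled by the error in \<open>L\<^sup>1\<close> for variance \<open>v\<close>.\<close>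

lemma heat_tendsto_AE:
  fixes h :: "real ^ 'm \<Rightarrow> real"
  assumes v: "v > 0" and hm [measurable]: "h \<in> borel_measurable borel"
    and int: "integrable (gaussian v) h"
  obtains s where "\<And>n. 0 < s n" "\<And>n. s n < v" "AE y in lborel. (\<lambda>n. heat (s n) h y) \<longlonglongrightarrow> h y"
proof -
  let ?G = "gaussian (v / 2) :: (real ^ 'm) measure" and ?N = "gaussian 1 :: (real ^ 'm) measure"
  define s where "s n = v / 2 * inverse (real (Suc n))" for n
  have s: "0 < s n" "s n \<le> v / 2" for n
    using v by (auto simp: s_def field_simps)
  have s0: "(\<lambda>n. sqrt (s n)) \<longlonglongrightarrow> 0"
  proof -
    have "(\<lambda>n. s n) \<longlonglongrightarrow> 0" unfolding s_def
      by (rule tendsto_mult_right_zero[OF LIMSEQ_inverse_real_of_nat])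
    then show ?thesis using tendsto_real_sqrt by fastforce
  qed
  interpret G: prob_space ?G by (rule prob_space_gaussian) (use v in auto)
  interpret N: prob_space ?N by (rule prob_space_gaussian) auto
  interpret P: pair_prob_space ?G ?N ..
  let ?C = "ennreal (sqrt 2 ^ CARD('m))"
  have shift: "(\<integral>\<^sup>+p. k (fst p + sqrt (s n) *\<^sub>R snd p) \<partial>(?G \<Otimes>\<^sub>M ?N)) \<le> ?C * (\<integral>\<^sup>+y. k y \<partial>gaussian v)"
    if [measurable]: "k \<in> borel_measurable borel" for k :: "real ^ 'm \<Rightarrow> ennreal" and n
  proof -
    have "(\<integral>\<^sup>+p. k (fst p + sqrt (s n) *\<^sub>R snd p) \<partial>(?G \<Otimes>\<^sub>M ?N)) = (\<integral>\<^sup>+y. \<integral>\<^sup>+z. k (y + sqrt (s n) *\<^sub>R z) \<partial>?N \<partial>?G)"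
      by (subst N.nn_integral_fst[symmetric]) auto
    also have "\<dots> = (\<integral>\<^sup>+y. \<integral>\<^sup>+w. k (y + w) \<partial>gaussian (s n) \<partial>?G)"
      by (subst distr_gaussian_sqrt[OF s(1), symmetric], subst nn_integral_distr) auto
    also have "\<dots> = (\<integral>\<^sup>+y. k y \<partial>gaussian (v / 2 + s n))"
      using v s by (intro nn_integral_gaussian_convolution) auto
    also have "\<dots> \<le> ?C * (\<integral>\<^sup>+y. k y \<partial>gaussian v)"
      using v s[of n] by (intro nn_integral_gaussian_comparison) auto
    finally show ?thesis .
  qed
  have stay: "(\<integral>\<^sup>+p. k (fst p) \<partial>(?G \<Otimes>\<^sub>M ?N)) \<le> ?C * (\<integral>\<^sup>+y. k y \<partial>gaussian v)"
    if [measurable]: "k \<in> borel_measurable borel" for k :: "real ^ 'm \<Rightarrow> ennreal"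
  proof -
    have "(\<integral>\<^sup>+p. k (fst p) \<partial>(?G \<Otimes>\<^sub>M ?N)) = (\<integral>\<^sup>+y. k y \<partial>?G)"
      by (subst N.nn_integral_fst[symmetric]) (auto simp: N.emeasure_space_1[simplified])
    also have "\<dots> \<le> ?C * (\<integral>\<^sup>+y. k y \<partial>gaussian v)"
      using v by (intro nn_integral_gaussian_comparison) auto
    finally show ?thesis .
  qed
  define D where "D n p = h (fst p + sqrt (s n) *\<^sub>R snd p) - h (fst p)" for n and p :: "(real ^ 'm) \<times> (real ^ 'm)"
  have Dm [measurable]: "D n \<in> borel_measurable (?G \<Otimes>\<^sub>M ?N)" for n
    unfolding D_def by measurable
  have hfin: "(\<integral>\<^sup>+y. ennreal \<bar>h y\<bar> \<partial>gaussian v) < \<infinity>"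
    using int by (simp add: integrable_iff_bounded)
  have Dint: "integrable (?G \<Otimes>\<^sub>M ?N) (D n)" for n
    unfolding D_def
  proof (intro Bochner_Integration.integrable_diff)
    have fin: "?C * (\<integral>\<^sup>+y. ennreal \<bar>h y\<bar> \<partial>gaussian v) < \<infinity>"
      using hfin by (simp add: ennreal_mult_less_top)
    show "integrable (?G \<Otimes>\<^sub>M ?N) (\<lambda>p. h (fst p + sqrt (s n) *\<^sub>R snd p))"
      using order.strict_trans1[OF shift[of "\<lambda>y. ennreal \<bar>h y\<bar>" n] fin] by (simp add: integrable_iff_bounded)
    show "integrable (?G \<Otimes>\<^sub>M ?N) (\<lambda>p. h (fst p))"
      using order.strict_trans1[OF stay[of "\<lambda>y. ennreal \<bar>h y\<bar>"] fin] by (simp add: integrable_iff_bounded)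
  qed
  have Dlim: "(\<lambda>n. \<integral>p. \<bar>D n p\<bar> \<partial>(?G \<Otimes>\<^sub>M ?N)) \<longlonglongrightarrow> 0"
  proof (rule order_tendstoI)
    fix \<epsilon> :: real assume e: "0 < \<epsilon>"
    define C where "C = sqrt 2 ^ CARD('m)"
    have C: "C > 0" by (simp add: C_def)
    \<comment> \<open>\<open>C\<close> is the factor lost in comparing Gaussian measures, so that the shifted and the unshifted
      approximation error contribute at most \<open>\<epsilon>/4\<close> each.\<close>
    obtain g K where g: "continuous_on UNIV g" and K: "\<And>y. \<bar>g y\<bar> \<le> K"
      and gh: "(\<integral>y. \<bar>h y - g y\<bar> \<partial>gaussian v) < \<epsilon> / (4 * C)"
      using continuous_approximation[OF v hm int, of "\<epsilon> / (4 * C)"] e C by auto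
    have [measurable]: "g \<in> borel_measurable borel"
      by (intro borel_measurable_continuous_onI g)
    interpret V: prob_space "gaussian v :: (real ^ 'm) measure"
      by (rule prob_space_gaussian[OF v])
    have gint: "integrable (gaussian v) g"
      by (rule V.integrable_const_bound[of _ K]) (auto simp: K)
    have gh': "(\<integral>\<^sup>+y. ennreal \<bar>h y - g y\<bar> \<partial>gaussian v) \<le> ennreal (\<epsilon> / (4 * C))"
      using gh int gint by (subst nn_integral_eq_integral) (auto intro!: ennreal_leI)
    have gh'': "?C * (\<integral>\<^sup>+y. ennreal \<bar>h y - g y\<bar> \<partial>gaussian v) \<le> ennreal (\<epsilon> / 4)"
    proof -
      have "?C * (\<integral>\<^sup>+y. ennreal \<bar>h y - g y\<bar> \<partial>gaussian v) \<le> ?C * ennreal (\<epsilon> / (4 * C))"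
        by (rule mult_left_mono[OF gh']) simp
      also have "\<dots> = ennreal (\<epsilon> / 4)"
        using C e by (simp add: C_def flip: ennreal_mult)
      finally show ?thesis .
    qed
    have "(\<lambda>n. \<integral>p. \<bar>g (fst p + sqrt (s n) *\<^sub>R snd p) - g (fst p)\<bar> \<partial>(?G \<Otimes>\<^sub>M ?N)) \<longlonglongrightarrow> (\<integral>p. 0 \<partial>(?G \<Otimes>\<^sub>M ?N))"
    proof (rule integral_dominated_convergence[where w = "\<lambda>_. 2 * K"])
      show "AE p in ?G \<Otimes>\<^sub>M ?N. (\<lambda>n. \<bar>g (fst p + sqrt (s n) *\<^sub>R snd p) - g (fst p)\<bar>) \<longlonglongrightarrow> 0"
      proof (rule AE_I2)
        fix p :: "(real ^ 'm) \<times> (real ^ 'm)"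
        have "(\<lambda>n. fst p + sqrt (s n) *\<^sub>R snd p) \<longlonglongrightarrow> fst p + 0 *\<^sub>R snd p"
          by (intro tendsto_intros s0)
        then have "(\<lambda>n. fst p + sqrt (s n) *\<^sub>R snd p) \<longlonglongrightarrow> fst p" by simp
        from continuous_on_tendsto_compose[OF g this]
        have "(\<lambda>n. g (fst p + sqrt (s n) *\<^sub>R snd p)) \<longlonglongrightarrow> g (fst p)" by simp
        then have "(\<lambda>n. \<bar>g (fst p + sqrt (s n) *\<^sub>R snd p) - g (fst p)\<bar>) \<longlonglongrightarrow> \<bar>g (fst p) - g (fst p)\<bar>"
          by (intro tendsto_intros)
        then show "(\<lambda>n. \<bar>g (fst p + sqrt (s n) *\<^sub>R snd p) - g (fst p)\<bar>) \<longlonglongrightarrow> 0" by simp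
      qed
      show "AE p in ?G \<Otimes>\<^sub>M ?N. norm \<bar>g (fst p + sqrt (s n) *\<^sub>R snd p) - g (fst p)\<bar> \<le> 2 * K" for n
        using K by (intro AE_I2) (smt (verit) real_norm_def)
    qed auto
    then have "(\<lambda>n. \<integral>p. \<bar>g (fst p + sqrt (s n) *\<^sub>R snd p) - g (fst p)\<bar> \<partial>(?G \<Otimes>\<^sub>M ?N)) \<longlonglongrightarrow> 0" by simp
    from order_tendstoD(2)[OF this, of "\<epsilon> / 4"] e
    have ev: "\<forall>\<^sub>F n in sequentially. (\<integral>p. \<bar>g (fst p + sqrt (s n) *\<^sub>R snd p) - g (fst p)\<bar> \<partial>(?G \<Otimes>\<^sub>M ?N)) < \<epsilon> / 4"
      by simp
    show "\<forall>\<^sub>F n in sequentially. (\<integral>p. \<bar>D n p\<bar> \<partial>(?G \<Otimes>\<^sub>M ?N)) < \<epsilon>"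
      using ev
    proof eventually_elim
      case (elim n)
      have gi: "integrable (?G \<Otimes>\<^sub>M ?N) (\<lambda>p. \<bar>g (fst p + sqrt (s n) *\<^sub>R snd p) - g (fst p)\<bar>)"
        by (intro integrable_abs Bochner_Integration.integrable_diff P.integrable_const_bound[of _ K] AE_I2)
          (simp_all add: K)
      have "ennreal (\<integral>p. \<bar>D n p\<bar> \<partial>(?G \<Otimes>\<^sub>M ?N)) = (\<integral>\<^sup>+p. ennreal \<bar>D n p\<bar> \<partial>(?G \<Otimes>\<^sub>M ?N))"
        using Dint[of n] by (subst nn_integral_eq_integral) auto
      also have "\<dots> \<le> (\<integral>\<^sup>+p. (ennreal \<bar>h (fst p + sqrt (s n) *\<^sub>R snd p) - g (fst p + sqrt (s n) *\<^sub>R snd p)\<bar>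
            + ennreal \<bar>h (fst p) - g (fst p)\<bar>) + ennreal \<bar>g (fst p + sqrt (s n) *\<^sub>R snd p) - g (fst p)\<bar> \<partial>(?G \<Otimes>\<^sub>M ?N))"
        unfolding D_def by (intro nn_integral_mono) (simp flip: ennreal_plus)
      also have "\<dots> = (\<integral>\<^sup>+p. ennreal \<bar>h (fst p + sqrt (s n) *\<^sub>R snd p) - g (fst p + sqrt (s n) *\<^sub>R snd p)\<bar> \<partial>(?G \<Otimes>\<^sub>M ?N))
            + (\<integral>\<^sup>+p. ennreal \<bar>h (fst p) - g (fst p)\<bar> \<partial>(?G \<Otimes>\<^sub>M ?N))
            + (\<integral>\<^sup>+p. ennreal \<bar>g (fst p + sqrt (s n) *\<^sub>R snd p) - g (fst p)\<bar> \<partial>(?G \<Otimes>\<^sub>M ?N))"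
        by (subst nn_integral_add, simp, simp, subst nn_integral_add) auto
      also have "\<dots> \<le> ennreal (\<epsilon> / 4) + ennreal (\<epsilon> / 4) + ennreal (\<epsilon> / 4)"
      proof (intro add_mono)
        show "(\<integral>\<^sup>+p. ennreal \<bar>h (fst p + sqrt (s n) *\<^sub>R snd p) - g (fst p + sqrt (s n) *\<^sub>R snd p)\<bar> \<partial>(?G \<Otimes>\<^sub>M ?N)) \<le> ennreal (\<epsilon> / 4)"
          by (rule order.trans[OF shift[of "\<lambda>y. ennreal \<bar>h y - g y\<bar>" n] gh'']) simp
        show "(\<integral>\<^sup>+p. ennreal \<bar>h (fst p) - g (fst p)\<bar> \<partial>(?G \<Otimes>\<^sub>M ?N)) \<le> ennreal (\<epsilon> / 4)"
          by (rule order.trans[OF stay[of "\<lambda>y. ennreal \<bar>h y - g y\<bar>"] gh'']) simp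
        show "(\<integral>\<^sup>+p. ennreal \<bar>g (fst p + sqrt (s n) *\<^sub>R snd p) - g (fst p)\<bar> \<partial>(?G \<Otimes>\<^sub>M ?N)) \<le> ennreal (\<epsilon> / 4)"
          using gi elim by (subst nn_integral_eq_integral) (auto intro!: ennreal_leI)
      qed
      also have "\<dots> = ennreal (3 * \<epsilon> / 4)"
        using e by (simp flip: ennreal_plus)
      also have "\<dots> < ennreal \<epsilon>" using e by (simp add: ennreal_lessI)
      finally show ?case using e by (simp add: ennreal_less_iff)
    qed
  qed (auto intro!: always_eventually intro: order.strict_trans2 integral_nonneg_AE)
  define u where "u n y = (\<integral>z. D n (y, z) \<partial>?N)" for n y
  have uint: "integrable ?G (u n)" for n
    unfolding u_def by (rule P.integrable_fst'[OF Dint])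
  have "(\<lambda>n. \<integral>y. norm (u n y) \<partial>?G) \<longlonglongrightarrow> 0"
  proof (rule tendsto_sandwich[OF _ _ tendsto_const Dlim])
    show "\<forall>\<^sub>F n in sequentially. (\<integral>y. norm (u n y) \<partial>?G) \<le> (\<integral>p. \<bar>D n p\<bar> \<partial>(?G \<Otimes>\<^sub>M ?N))"
    proof (rule always_eventually, rule allI)
      fix n
      have "(\<integral>y. norm (u n y) \<partial>?G) \<le> (\<integral>y. (\<integral>z. \<bar>D n (y, z)\<bar> \<partial>?N) \<partial>?G)"
      proof (rule integral_mono)
        show "integrable ?G (\<lambda>y. \<integral>z. \<bar>D n (y, z)\<bar> \<partial>?N)"
          using P.integrable_fst'[OF integrable_abs[OF Dint[of n]]] by simp
        show "norm (u n y) \<le> (\<integral>z. \<bar>D n (y, z)\<bar> \<partial>?N)" for y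
          unfolding u_def using integral_norm_bound[of ?N "\<lambda>z. D n (y, z)"] by simp
      qed (use uint in auto)
      also have "\<dots> = (\<integral>p. \<bar>D n p\<bar> \<partial>(?G \<Otimes>\<^sub>M ?N))"
        using P.integral_fst'[OF integrable_abs[OF Dint[of n]]] by simp
      finally show "(\<integral>y. norm (u n y) \<partial>?G) \<le> (\<integral>p. \<bar>D n p\<bar> \<partial>(?G \<Otimes>\<^sub>M ?N))" .
    qed
  qed auto
  from tendsto_L1_AE_subseq[OF uint this] obtain r :: "nat \<Rightarrow> nat"
    where r: "AE y in ?G. (\<lambda>n. u (r n) y) \<longlonglongrightarrow> 0" by auto
  have "AE y in ?G. \<forall>n. integrable ?N (\<lambda>z. D n (y, z))"
    using P.AE_integrable_fst'[OF Dint] by (simp add: AE_all_countable)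
  with r have "AE y in ?G. (\<lambda>n. heat (s (r n)) h y) \<longlonglongrightarrow> h y"
  proof eventually_elim
    case (elim y)
    have "u n y = heat (s n) h y - h y" for n
    proof -
      have "integrable ?N (\<lambda>z. D n (y, z) + h y)"
        using elim by auto
      then have "integrable ?N (\<lambda>z. h (y + sqrt (s n) *\<^sub>R z))"
        by (simp add: D_def)
      then show ?thesis
        by (simp add: u_def D_def heat_def N.prob_space[simplified])
    qed
    then have "(\<lambda>n. heat (s (r n)) h y - h y) \<longlonglongrightarrow> 0"
      using elim by simp
    then show ?case by (simp add: LIM_zero_iff)
  qed
  then have "AE y in lborel. (\<lambda>n. heat (s (r n)) h y) \<longlonglongrightarrow> h y"
    using v by (simp add: AE_gaussian_iff)
  moreover have "s (r n) < v" for n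
    using s(2)[of "r n"] v by linarith
  ultimately show ?thesis
    using s(1) by (intro that[of "\<lambda>n. s (r n)"])
qed

text \<open>The Taylor polynomials of the heat flow at \<open>0\<close> need not have convergent coefficients a priori.
  But at a point where the heat flow converges, their values stay bounded.  Almost every \<open>y\<^sub>0\<close> is such
  a point together with all its neighbours \<open>y\<^sub>0 + e\<^sub>i\<close>, and the values at these points determine the
  coefficients.  So the coefficients are bounded, and a subsequence of them converges.\<close>

lemma taylor_bound_AE:
  fixes h :: "real ^ 'm \<Rightarrow> real"
  assumes v: "v > 0" and hm: "h \<in> borel_measurable borel" and int: "integrable (gaussian v) h"
    and d: "\<And>s i y. 0 < s \<Longrightarrow> s < v \<Longrightarrow> partial_differentiable i (heat s h) y"
    and d2: "\<And>s i k y. 0 < s \<Longrightarrow> s < v \<Longrightarrow> partial_differentiable k (partial_deriv i (heat s h)) y"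
    and B: "\<And>s i k y. 0 < s \<Longrightarrow> s < v \<Longrightarrow> \<bar>partial_deriv k (partial_deriv i (heat s h)) y\<bar> \<le> B"
  obtains a and b :: "real ^ 'm"
  where "AE y in lborel. \<bar>h y - (a + b \<bullet> y)\<bar> \<le> B * (\<Sum>i\<in>UNIV. \<bar>y $ i\<bar>)\<^sup>2"
proof -
  obtain s where s: "\<And>n. 0 < s n" "\<And>n. s n < v" and lim: "AE y in lborel. (\<lambda>n. heat (s n) h y) \<longlonglongrightarrow> h y"
    using heat_tendsto_AE[OF v hm int] by blast
  define A where "A n = heat (s n) h 0" for n
  define b where "b n = (\<chi> i. partial_deriv i (heat (s n) h) 0)" for n
  let ?R = "\<lambda>y. B * (\<Sum>i\<in>UNIV. \<bar>y $ i\<bar>)\<^sup>2"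
  have expansion: "\<bar>heat (s n) h y - (A n + b n \<bullet> y)\<bar> \<le> ?R y" for n y
    using first_order_expansion[of "heat (s n) h" B y, OF d[OF s] d2[OF s] B[OF s]]
    by (simp add: A_def b_def inner_vec_def algebra_simps)
  have bounded_at: "\<exists>K. \<forall>n. \<bar>A n + b n \<bullet> y\<bar> \<le> K" if conv: "(\<lambda>n. heat (s n) h y) \<longlonglongrightarrow> h y" for y
  proof -
    obtain K where K: "\<bar>heat (s n) h y\<bar> \<le> K" for n
      using convergent_imp_Bseq[OF convergentI[OF conv]] by (auto simp: Bseq_def)
    have "\<bar>A n + b n \<bullet> y\<bar> \<le> K + ?R y" for n
      using expansion[of n y] K[of n] by linarith
    then show ?thesis by blast
  qed
  have "AE y in lborel. (\<lambda>n. heat (s n) h (y + axis i 1)) \<longlonglongrightarrow> h (y + axis i 1)" for i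
  proof -
    have "AE y in distr lborel borel ((+) (axis i 1)). (\<lambda>n. heat (s n) h y) \<longlonglongrightarrow> h y"
      unfolding lborel_distr_plus by (rule lim)
    from AE_distrD[OF _ this] show ?thesis
      by (simp add: add.commute)
  qed
  then have "AE y in lborel. \<forall>i. (\<lambda>n. heat (s n) h (y + axis i 1)) \<longlonglongrightarrow> h (y + axis i 1)"
    by (simp add: AE_all_countable)
  with lim have "AE y in (lborel :: (real ^ 'm) measure). (\<lambda>n. heat (s n) h y) \<longlonglongrightarrow> h y \<and>
      (\<forall>i. (\<lambda>n. heat (s n) h (y + axis i 1)) \<longlonglongrightarrow> h (y + axis i 1))"
    by eventually_elim auto
  moreover have "ae_filter (lborel :: (real ^ 'm) measure) \<noteq> bot"
    by (simp add: ae_filter_eq_bot_iff)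
  ultimately obtain y0 where y0: "(\<lambda>n. heat (s n) h y0) \<longlonglongrightarrow> h y0"
      "\<And>i. (\<lambda>n. heat (s n) h (y0 + axis i 1)) \<longlonglongrightarrow> h (y0 + axis i 1)"
    using eventually_happens' by blast
  obtain K0 where K0: "\<bar>A n + b n \<bullet> y0\<bar> \<le> K0" for n
    using bounded_at[OF y0(1)] by blast
  have "\<forall>i. \<exists>K. \<forall>n. \<bar>A n + b n \<bullet> (y0 + axis i 1)\<bar> \<le> K"
    using bounded_at[OF y0(2)] by blast
  then obtain K1 where K1: "\<bar>A n + b n \<bullet> (y0 + axis i 1)\<bar> \<le> K1 i" for i n
    by metis
  have bi: "\<bar>b n $ i\<bar> \<le> K1 i + K0" for n i
  proof -
    have "b n $ i = (A n + b n \<bullet> (y0 + axis i 1)) - (A n + b n \<bullet> y0)"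
      by (simp add: inner_add_right inner_axis)
    then show ?thesis using K0[of n] K1[of n i] by linarith
  qed
  have bn: "norm (b n) \<le> (\<Sum>i\<in>UNIV. K1 i + K0)" for n
    by (rule order.trans[OF norm_le_l1_cart sum_mono]) (simp add: bi)
  have An: "\<bar>A n\<bar> \<le> K0 + (\<Sum>i\<in>UNIV. K1 i + K0) * norm y0" for n
  proof -
    have "\<bar>b n \<bullet> y0\<bar> \<le> norm (b n) * norm y0" by (rule Cauchy_Schwarz_ineq2)
    also have "\<dots> \<le> (\<Sum>i\<in>UNIV. K1 i + K0) * norm y0" by (intro mult_right_mono bn) auto
    finally show ?thesis using K0[of n] by linarith
  qed
  have "bounded (range (\<lambda>n. (A n, b n)))"
  proof (rule boundedI)
    fix p assume "p \<in> range (\<lambda>n. (A n, b n))"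
    then obtain n where p: "p = (A n, b n)" by blast
    have "norm p \<le> norm (A n) + norm (b n)"
      unfolding p by (rule norm_Pair_le)
    also have "\<dots> \<le> (K0 + (\<Sum>i\<in>UNIV. K1 i + K0) * norm y0) + (\<Sum>i\<in>UNIV. K1 i + K0)"
      using An[of n] bn[of n] by simp
    finally show "norm p \<le> (K0 + (\<Sum>i\<in>UNIV. K1 i + K0) * norm y0) + (\<Sum>i\<in>UNIV. K1 i + K0)" .
  qed
  from bounded_imp_convergent_subsequence[OF this]
  obtain l r where r: "strict_mono (r :: nat \<Rightarrow> nat)" and l: "((\<lambda>n. (A n, b n)) \<circ> r) \<longlonglongrightarrow> l"
    by blast
  obtain a0 b0 where l_eq: "l = (a0, b0)" by (cases l)
  have A_lim: "(\<lambda>n. A (r n)) \<longlonglongrightarrow> a0" and b_lim: "(\<lambda>n. b (r n)) \<longlonglongrightarrow> b0"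
    using tendsto_fst[OF l] tendsto_snd[OF l] by (auto simp: o_def l_eq)
  have "AE y in lborel. \<bar>h y - (a0 + b0 \<bullet> y)\<bar> \<le> ?R y"
    using lim
  proof eventually_elim
    case (elim y)
    have "(\<lambda>n. heat (s (r n)) h y) \<longlonglongrightarrow> h y"
      using LIMSEQ_subseq_LIMSEQ[OF elim r] by (simp add: o_def)
    then have "(\<lambda>n. \<bar>heat (s (r n)) h y - (A (r n) + b (r n) \<bullet> y)\<bar>) \<longlonglongrightarrow> \<bar>h y - (a0 + b0 \<bullet> y)\<bar>"
      by (intro tendsto_intros A_lim b_lim)
    then show ?case
      by (rule LIMSEQ_le_const2) (use expansion in auto)
  qed
  then show ?thesis by (rule that)
qed

section \<open>Affine projection in the Gaussian \<open>L\<^sup>2\<close> space\<close>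

lemma integrable_mult_square:
  fixes f g :: "'a \<Rightarrow> real"
  assumes [measurable]: "f \<in> borel_measurable M" "g \<in> borel_measurable M"
    and "integrable M (\<lambda>x. (f x)\<^sup>2)" "integrable M (\<lambda>x. (g x)\<^sup>2)"
  shows "integrable M (\<lambda>x. f x * g x)"
proof (rule Bochner_Integration.integrable_bound)
  show "integrable M (\<lambda>x. (f x)\<^sup>2 + (g x)\<^sup>2)"
    using assms by simp
  show "AE x in M. norm (f x * g x) \<le> norm ((f x)\<^sup>2 + (g x)\<^sup>2)"
  proof (rule AE_I2)
    fix x
    have "2 * \<bar>f x * g x\<bar> \<le> (f x)\<^sup>2 + (g x)\<^sup>2"
      using sum_squares_bound[of "\<bar>f x\<bar>" "\<bar>g x\<bar>"] by (simp add: abs_mult)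
    then show "norm (f x * g x) \<le> norm ((f x)\<^sup>2 + (g x)\<^sup>2)" by simp
  qed
qed simp

lemma integrable_square_add:
  fixes f g :: "'a \<Rightarrow> real"
  assumes [measurable]: "f \<in> borel_measurable M" "g \<in> borel_measurable M"
    and "integrable M (\<lambda>x. (f x)\<^sup>2)" "integrable M (\<lambda>x. (g x)\<^sup>2)"
  shows "integrable M (\<lambda>x. (f x + g x)\<^sup>2)"
  using assms integrable_mult_square[OF assms] by (simp add: power2_sum mult.assoc)

lemma integrable_square_sum:
  fixes f :: "'i \<Rightarrow> 'a \<Rightarrow> real"
  assumes [measurable]: "\<And>i. i \<in> I \<Longrightarrow> f i \<in> borel_measurable M"
    and "\<And>i. i \<in> I \<Longrightarrow> integrable M (\<lambda>x. (f i x)\<^sup>2)"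
  shows "integrable M (\<lambda>x. (\<Sum>i\<in>I. f i x)\<^sup>2)"
  using assms
proof (induction I rule: infinite_finite_induct)
  case (insert i I)
  have "integrable M (\<lambda>x. (f i x + (\<Sum>i\<in>I. f i x))\<^sup>2)"
    by (rule integrable_square_add) (use insert in auto)
  then show ?case using insert by simp
qed auto

lemma integrable_gaussian_affine_square:
  assumes v: "v > 0"
  shows "integrable (gaussian v) (\<lambda>y :: real ^ 'm. (a + (\<Sum>i\<in>UNIV. b i * y $ i))\<^sup>2)"
proof -
  interpret G: prob_space "gaussian v :: (real ^ 'm) measure"
    by (rule prob_space_gaussian[OF v])
  have "integrable (gaussian v) (\<lambda>y :: real ^ 'm. (b i * y $ i)\<^sup>2)" for i
    using gaussian_second_moment[OF v, of i] by (auto simp: power_mult_distrib has_bochner_integral_iff)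
  then show ?thesis
    by (intro integrable_square_add integrable_square_sum) auto
qed

lemma exp_increment_bound: "\<bar>exp c - 1\<bar> \<le> \<bar>c\<bar> * exp \<bar>c\<bar>" for c :: real
proof (cases "c \<ge> 0")
  case True
  have "1 - c \<le> exp (- c)" using exp_ge_add_one_self[of "- c"] by linarith
  then have "(1 - c) * exp c \<le> exp (- c) * exp c" by (rule mult_right_mono) simp
  then show ?thesis using True by (simp add: algebra_simps flip: exp_add)
next
  case False
  have "1 - exp c \<le> - c * 1" using exp_ge_add_one_self[of c] by linarith
  also have "\<dots> \<le> - c * exp (- c)" using False by (intro mult_left_mono) auto
  finally show ?thesis using False by simp
qed

text \<open>Gaussian integration by parts for a square integrable function without any regularity: after
  the Cameron--Martin shift only the exponential density depends on the parameter, and it can be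
  differentiated under the integral.\<close>

lemma gaussian_stein:
  fixes h :: "real ^ 'm \<Rightarrow> real"
  assumes v: "v > 0" and hm [measurable]: "h \<in> borel_measurable borel"
    and sq: "integrable (gaussian v) (\<lambda>w. (h w)\<^sup>2)"
  shows "partial_deriv i (heat v h) 0 = (\<integral>w. h w * w $ i \<partial>gaussian v) / v"
proof -
  let ?G = "gaussian v :: (real ^ 'm) measure"
  define E where "E s w = exp ((s * w $ i - s * s / 2) / v)" for s and w :: "real ^ 'm"
  have [measurable]: "E s \<in> borel_measurable borel" for s
    unfolding E_def by measurable
  have E_sq: "integrable ?G (\<lambda>w. (E s w)\<^sup>2)" for s
  proof -
    have "(E s w)\<^sup>2 = exp (- (s * s) / v) * exp ((2 * s / v) * w $ i)" for w
    proof -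
      have "2 * ((s * w $ i - s * s / 2) / v) = - (s * s) / v + (2 * s / v) * w $ i"
        using v by (simp add: field_simps)
      then show ?thesis
        unfolding E_def by (simp only: exp_add flip: exp_double)
    qed
    then show ?thesis using integrable_gaussian_exp[OF v, of "2 * s / v" i] by simp
  qed
  have Eh: "integrable ?G (\<lambda>w. E s w * h w)" for s
    by (intro integrable_mult_square E_sq sq) auto
  have heat_E: "heat v h (s *\<^sub>R axis i 1) = (\<integral>w. E s w * h w \<partial>?G)" for s
    using integral_gaussian_shift[OF v hm, of "s *\<^sub>R axis i 1"]
    by (simp add: heat_eq[OF v hm] E_def inner_axis' inner_axis)
  have "((\<lambda>s. heat v h (s *\<^sub>R axis i 1)) has_real_derivative (\<integral>w. h w * w $ i / v \<partial>?G)) (at 0)"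
    unfolding has_field_derivative_iff tendsto_at_iff_sequentially
  proof (intro allI impI)
    fix X :: "nat \<Rightarrow> real" assume X0: "\<forall>n. X n \<in> UNIV - {0}" and X: "X \<longlonglongrightarrow> 0"
    obtain R where R: "R > 0" "\<And>n. \<bar>X n\<bar> \<le> R"
      using convergent_imp_Bseq[OF convergentI[OF X]] by (auto simp: Bseq_def)
    \<comment> \<open>With \<open>\<kappa> = (|w\<^sub>i| + R) / v\<close> the difference quotient is at most \<open>\<kappa> exp(R \<kappa>) \<le> exp((R + 1) \<kappa>)\<close>,
      which \<open>k\<close> and \<open>G\<close> rewrite as a sum of two exponentials of linear functions.\<close>
    define k where "k = (R + 1) / v"
    define G where "G w = exp (k * R) * (exp (k * w $ i) + exp (- k * w $ i))" for w :: "real ^ 'm"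
    have [measurable]: "G \<in> borel_measurable borel"
      unfolding G_def by measurable
    have G_sq: "integrable ?G (\<lambda>w. (G w)\<^sup>2)"
    proof -
      have "integrable ?G (\<lambda>w. (exp (k * w $ i) + exp (- k * w $ i))\<^sup>2)"
        using integrable_gaussian_exp[OF v, of "2 * k" i] integrable_gaussian_exp[OF v, of "- 2 * k" i]
        by (intro integrable_square_add) (auto simp: mult.assoc simp flip: exp_double)
      then show ?thesis by (simp add: G_def power_mult_distrib)
    qed
    have E_bound: "\<bar>(E (X n) w - 1) / X n\<bar> \<le> G w" for n w
    proof -
      let ?x = "w $ i" and ?s = "X n"
      let ?c = "(?s * ?x - ?s * ?s / 2) / v" and ?K = "(\<bar>?x\<bar> + R) / v"
      have s: "?s \<noteq> 0" "\<bar>?s\<bar> \<le> R" using X0 R by auto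
      have K0: "0 \<le> ?K" using v R by simp
      have "?c = ?s * ((?x - ?s / 2) / v)" by (simp add: field_simps)
      then have "\<bar>?c\<bar> = \<bar>?s\<bar> * (\<bar>?x - ?s / 2\<bar> / v)" using v by (simp add: abs_mult)
      also have "\<dots> \<le> \<bar>?s\<bar> * ?K" using v s by (intro mult_left_mono divide_right_mono) auto
      finally have c: "\<bar>?c\<bar> \<le> \<bar>?s\<bar> * ?K" .
      also have "\<dots> \<le> R * ?K" using s K0 by (intro mult_right_mono)
      finally have c': "\<bar>?c\<bar> \<le> R * ?K" .
      have "\<bar>E ?s w - 1\<bar> \<le> \<bar>?c\<bar> * exp \<bar>?c\<bar>"
        unfolding E_def by (rule exp_increment_bound)
      also have "\<dots> \<le> (\<bar>?s\<bar> * ?K) * exp (R * ?K)"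
        using c c' K0 by (intro mult_mono mult_nonneg_nonneg) auto
      also have "\<dots> \<le> (\<bar>?s\<bar> * exp ?K) * exp (R * ?K)"
      proof -
        have "?K \<le> exp ?K" using exp_ge_add_one_self[of ?K] by linarith
        then show ?thesis by (intro mult_right_mono mult_left_mono) auto
      qed
      finally have "\<bar>(E ?s w - 1) / ?s\<bar> \<le> exp ?K * exp (R * ?K)"
        using s by (simp add: field_simps)
      also have "\<dots> = exp (k * R) * exp (k * \<bar>?x\<bar>)"
        using v by (simp add: k_def field_simps flip: exp_add)
      also have "\<dots> \<le> G w"
        unfolding G_def by (intro mult_left_mono) (auto simp: abs_if)
      finally show ?thesis .
    qed
    have "(\<lambda>n. \<integral>w. (E (X n) w - 1) / X n * h w \<partial>?G) \<longlonglongrightarrow> (\<integral>w. h w * w $ i / v \<partial>?G)"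
    proof (rule integral_dominated_convergence[where w = "\<lambda>w. G w * \<bar>h w\<bar>"])
      show "integrable ?G (\<lambda>w. G w * \<bar>h w\<bar>)"
        by (intro integrable_mult_square G_sq) (use sq in auto)
      show "AE w in ?G. norm ((E (X n) w - 1) / X n * h w) \<le> G w * \<bar>h w\<bar>" for n
      proof (rule AE_I2)
        fix w
        show "norm ((E (X n) w - 1) / X n * h w) \<le> G w * \<bar>h w\<bar>"
          unfolding real_norm_def abs_mult[of _ "h w"] by (intro mult_right_mono E_bound) auto
      qed
      show "AE w in ?G. (\<lambda>n. (E (X n) w - 1) / X n * h w) \<longlonglongrightarrow> h w * w $ i / v"
      proof (rule AE_I2)
        fix w :: "real ^ 'm"
        have "((\<lambda>s. E s w) has_real_derivative w $ i / v) (at 0)"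
          unfolding E_def using v by (auto intro!: derivative_eq_intros)
        then have "((\<lambda>s. (E s w - 1) / s) \<longlongrightarrow> w $ i / v) (at 0)"
          by (simp add: has_field_derivative_iff E_def)
        then have "(\<lambda>n. (E (X n) w - 1) / X n) \<longlonglongrightarrow> w $ i / v"
          using X0 X unfolding tendsto_at_iff_sequentially by (auto simp: o_def)
        from tendsto_mult[OF this tendsto_const]
        have "(\<lambda>n. (E (X n) w - 1) / X n * h w) \<longlonglongrightarrow> w $ i / v * h w" .
        then show "(\<lambda>n. (E (X n) w - 1) / X n * h w) \<longlonglongrightarrow> h w * w $ i / v"
          by (simp add: mult.commute)
      qed
    qed auto
    moreover have "(\<integral>w. (E s w - 1) / s * h w \<partial>?G) = (heat v h (s *\<^sub>R axis i 1) - heat v h (0 *\<^sub>R axis i 1)) / (s - 0)" for s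
    proof -
      have "E 0 w = 1" for w by (simp add: E_def)
      then have "(\<integral>w. (E s w - 1) / s * h w \<partial>?G) = (\<integral>w. (E s w * h w - E 0 w * h w) / s \<partial>?G)"
        by (simp add: algebra_simps diff_divide_distrib)
      then show ?thesis unfolding heat_E using Eh by simp
    qed
    ultimately show "((\<lambda>y. (heat v h (y *\<^sub>R axis i 1) - heat v h (0 *\<^sub>R axis i 1)) / (y - 0)) \<circ> X)
        \<longlonglongrightarrow> (\<integral>w. h w * w $ i / v \<partial>?G)"
      by (simp only: o_def)
  qed
  then show ?thesis
    by (simp add: partial_deriv_def DERIV_imp_deriv)
qed

text \<open>The residual \<open>r\<close> is orthogonal to \<open>1\<close> and to all coordinates, and \<open>h - (a + b \<bullet> w)\<close>
  differs from \<open>r\<close> by an affine function; Pythagoras gives the last claim.\<close>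

lemma gaussian_affine_residual:
  fixes h :: "real ^ 'm \<Rightarrow> real"
  assumes v: "v > 0" and hm [measurable]: "h \<in> borel_measurable borel"
    and sq: "integrable (gaussian v) (\<lambda>w. (h w)\<^sup>2)"
  defines "r \<equiv> \<lambda>w. h w - (\<integral>w. h w \<partial>gaussian v) - (\<Sum>i\<in>UNIV. (\<integral>w. h w * w $ i \<partial>gaussian v) / v * w $ i)"
  shows "integrable (gaussian v) (\<lambda>w. (r w)\<^sup>2)"
    and "integrable (gaussian v) r"
    and "(\<integral>w. r w \<partial>gaussian v) = 0"
    and "(\<integral>w. (r w)\<^sup>2 \<partial>gaussian v) \<le> (\<integral>w. (h w - (a + b \<bullet> w))\<^sup>2 \<partial>gaussian v)"
proof -
  let ?G = "gaussian v :: (real ^ 'm) measure"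
  interpret G: prob_space ?G by (rule prob_space_gaussian[OF v])
  define \<alpha> where "\<alpha> = (\<integral>w. h w \<partial>?G)"
  define \<beta> where "\<beta> i = (\<integral>w. h w * w $ i \<partial>?G)" for i
  have r_eq: "r w = h w - \<alpha> - (\<Sum>i\<in>UNIV. \<beta> i / v * w $ i)" for w
    by (simp add: r_def \<alpha>_def \<beta>_def)
  have [measurable]: "r \<in> borel_measurable borel"
    unfolding r_def by measurable
  have r_eq': "r w = h w + (- \<alpha> + (\<Sum>i\<in>UNIV. - (\<beta> i / v) * w $ i))" for w
    by (simp add: r_eq sum_negf)
  have r_sq: "integrable ?G (\<lambda>w. (r w)\<^sup>2)"
    unfolding r_eq' by (intro integrable_square_add sq integrable_gaussian_affine_square[OF v]) auto
  have comp_sq: "integrable ?G (\<lambda>w. (w $ i)\<^sup>2)" and comp_int: "integrable ?G (\<lambda>w. w $ i)"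
    and comp_mean: "(\<integral>w. w $ i \<partial>?G) = 0" for i
    using gaussian_second_moment[OF v, of i] gaussian_mean[OF v, of i] by (auto simp: has_bochner_integral_iff)
  have comp_prod_int: "integrable ?G (\<lambda>w. w $ i * w $ k)" for i k
    by (intro integrable_mult_square comp_sq) auto
  have comp_prod: "(\<integral>w. w $ i * w $ k \<partial>?G) = (if i = k then v else 0)" for i k
    using gaussian_second_moment[OF v, of k] gaussian_cross_moment[OF v, of i k]
    by (auto simp: has_bochner_integral_iff power2_eq_square)
  have h_int: "integrable ?G h" and r_int: "integrable ?G r"
    using sq r_sq by (auto intro: G.square_integrable_imp_integrable)
  have h_comp: "integrable ?G (\<lambda>w. h w * w $ i)" and r_comp: "integrable ?G (\<lambda>w. r w * w $ i)" for i
    by (intro integrable_mult_square comp_sq sq r_sq; simp)+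
  have r_mean: "(\<integral>w. r w \<partial>?G) = 0"
    unfolding r_eq using h_int comp_int comp_mean by (simp add: \<alpha>_def G.prob_space[simplified])
  have r_orth: "(\<integral>w. r w * w $ k \<partial>?G) = 0" for k
  proof -
    have "r w * w $ k = h w * w $ k - \<alpha> * w $ k - (\<Sum>i\<in>UNIV. \<beta> i / v * (w $ i * w $ k))" for w
      unfolding r_eq by (simp add: left_diff_distrib sum_distrib_right mult.assoc)
    then have "(\<integral>w. r w * w $ k \<partial>?G) = \<beta> k - \<alpha> * 0 - (\<Sum>i\<in>UNIV. \<beta> i / v * (if i = k then v else 0))"
      using h_comp[of k] comp_int comp_prod_int
      by (simp add: comp_mean comp_prod \<beta>_def)
    also have "\<dots> = 0" using v by (simp add: if_distrib[of "(*) _"] cong: if_cong)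
    finally show ?thesis .
  qed
  define c where "c = \<alpha> - a"
  define d where "d i = \<beta> i / v - b $ i" for i
  define p where "p w = c + (\<Sum>i\<in>UNIV. d i * w $ i)" for w :: "real ^ 'm"
  have [measurable]: "p \<in> borel_measurable borel"
    unfolding p_def by measurable
  have p_sq: "integrable ?G (\<lambda>w. (p w)\<^sup>2)"
    unfolding p_def by (rule integrable_gaussian_affine_square[OF v])
  have split: "h w - (a + b \<bullet> w) = r w + p w" for w
    unfolding r_eq p_def c_def d_def inner_vec_def
    by (simp add: left_diff_distrib sum_subtractf)
  have rp_eq: "r w * p w = c * r w + (\<Sum>i\<in>UNIV. d i * (r w * w $ i))" for w
    unfolding p_def by (simp add: distrib_left sum_distrib_left mult_ac)
  have rp: "integrable ?G (\<lambda>w. r w * p w)" "(\<integral>w. r w * p w \<partial>?G) = 0"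
    unfolding rp_eq using r_int r_comp by (simp_all add: r_mean r_orth)
  have "(\<integral>w. (h w - (a + b \<bullet> w))\<^sup>2 \<partial>?G) = (\<integral>w. (r w)\<^sup>2 + (p w)\<^sup>2 + 2 * (r w * p w) \<partial>?G)"
    unfolding split by (simp add: power2_sum mult.assoc)
  also have "\<dots> = (\<integral>w. (r w)\<^sup>2 \<partial>?G) + (\<integral>w. (p w)\<^sup>2 \<partial>?G)"
    using r_sq p_sq rp by simp
  finally show "(\<integral>w. (r w)\<^sup>2 \<partial>?G) \<le> (\<integral>w. (h w - (a + b \<bullet> w))\<^sup>2 \<partial>?G)"
    using Bochner_Integration.integral_nonneg[of ?G "\<lambda>w. (p w)\<^sup>2"] by simp
  show "integrable ?G (\<lambda>w. (r w)\<^sup>2)" "integrable ?G r" "(\<integral>w. r w \<partial>?G) = 0"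
    by (fact r_sq r_int r_mean)+
qed

lemma integrable_gaussian_l1_power4:
  assumes v: "v > 0"
  shows "integrable (gaussian v) (\<lambda>w :: real ^ 'm. (\<Sum>i\<in>UNIV. \<bar>w $ i\<bar>) ^ 4)"
proof -
  have sq: "integrable (gaussian v) (\<lambda>w :: real ^ 'm. (\<Sum>i\<in>UNIV. (w $ i)\<^sup>2)\<^sup>2)"
    using integrable_gaussian_power4[OF v]
    by (intro integrable_square_sum) (auto simp flip: power_mult)
  show ?thesis
  proof (rule Bochner_Integration.integrable_bound)
    show "integrable (gaussian v) (\<lambda>w :: real ^ 'm. (real CARD('m))\<^sup>2 * (\<Sum>i\<in>UNIV. (w $ i)\<^sup>2)\<^sup>2)"
      using sq by simp
    show "AE w in gaussian v. norm ((\<Sum>i\<in>UNIV. \<bar>(w :: real ^ 'm) $ i\<bar>) ^ 4)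
        \<le> norm ((real CARD('m))\<^sup>2 * (\<Sum>i\<in>UNIV. (w $ i)\<^sup>2)\<^sup>2)"
    proof (rule AE_I2)
      fix w :: "real ^ 'm"
      have "(\<Sum>i\<in>UNIV. \<bar>w $ i\<bar>)\<^sup>2 \<le> (\<Sum>i\<in>UNIV. (w $ i)\<^sup>2) * real CARD('m)"
        using sum_squared_le_sum_of_squares[of "\<lambda>i. \<bar>w $ i\<bar>" UNIV] by simp
      then have "((\<Sum>i\<in>UNIV. \<bar>w $ i\<bar>)\<^sup>2)\<^sup>2 \<le> ((\<Sum>i\<in>UNIV. (w $ i)\<^sup>2) * real CARD('m))\<^sup>2"
        by (rule power_mono) simp
      then show "norm ((\<Sum>i\<in>UNIV. \<bar>w $ i\<bar>) ^ 4) \<le> norm ((real CARD('m))\<^sup>2 * (\<Sum>i\<in>UNIV. (w $ i)\<^sup>2)\<^sup>2)"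
        by (simp add: power_mult_distrib mult.commute sum_nonneg flip: power_mult)
    qed
  qed simp
qed

text \<open>The constant arises as the second moment of \<open>|z|\<^sub>1\<^sup>2\<close>, the size of the Taylor remainder.\<close>

definition l1_fourth_moment :: "'m::finite itself \<Rightarrow> real" where
  "l1_fourth_moment _ = (\<integral>z. (\<Sum>i\<in>UNIV. \<bar>z $ i\<bar>) ^ 4 \<partial>(gaussian 1 :: (real ^ 'm) measure))"

lemma gaussian_l1_power4_scaling:
  assumes v: "v > 0"
  shows "(\<integral>w. (\<Sum>i\<in>UNIV. \<bar>w $ i\<bar>) ^ 4 \<partial>(gaussian v :: (real ^ 'm) measure)) = v\<^sup>2 * l1_fourth_moment TYPE('m)"
proof -
  have "(\<integral>w. (\<Sum>i\<in>UNIV. \<bar>w $ i\<bar>) ^ 4 \<partial>(gaussian v :: (real ^ 'm) measure)) = (\<integral>w. (\<Sum>i\<in>UNIV. \<bar>sqrt v * w $ i\<bar>) ^ 4 \<partial>(gaussian 1 :: (real ^ 'm) measure))"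
    by (subst distr_gaussian_sqrt[OF v, symmetric], subst integral_distr) auto
  also have "(\<lambda>w :: real ^ 'm. (\<Sum>i\<in>UNIV. \<bar>sqrt v * w $ i\<bar>) ^ 4) = (\<lambda>w. v\<^sup>2 * (\<Sum>i\<in>UNIV. \<bar>w $ i\<bar>) ^ 4)"
  proof
    fix w :: "real ^ 'm"
    have "sqrt v ^ 4 = v\<^sup>2"
      using v power_mult[of "sqrt v" 2 2] by simp
    then show "(\<Sum>i\<in>UNIV. \<bar>sqrt v * w $ i\<bar>) ^ 4 = v\<^sup>2 * (\<Sum>i\<in>UNIV. \<bar>w $ i\<bar>) ^ 4"
      using v by (simp add: abs_mult power_mult_distrib flip: sum_distrib_left)
  qed
  finally show ?thesis by (simp add: l1_fourth_moment_def)
qed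

text \<open>The analytic core: one step of the scheme contributes a variance of second order in the step
  size \<open>v\<close>.\<close>

lemma heat_residual_bound:
  fixes h :: "real ^ 'm \<Rightarrow> real"
  assumes v: "v > 0" and hm [measurable]: "h \<in> borel_measurable borel" and int: "integrable (gaussian v) h"
    and d: "\<And>s i y. 0 < s \<Longrightarrow> s < v \<Longrightarrow> partial_differentiable i (heat s h) y"
    and d2: "\<And>s i k y. 0 < s \<Longrightarrow> s < v \<Longrightarrow> partial_differentiable k (partial_deriv i (heat s h)) y"
    and B: "\<And>s i k y. 0 < s \<Longrightarrow> s < v \<Longrightarrow> \<bar>partial_deriv k (partial_deriv i (heat s h)) y\<bar> \<le> B"
  defines "r \<equiv> \<lambda>w. h w - heat v h 0 - (\<Sum>i\<in>UNIV. partial_deriv i (heat v h) 0 * w $ i)"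
  shows "integrable (gaussian v) (\<lambda>w. (h w)\<^sup>2)"
    and "integrable (gaussian v) r" and "integrable (gaussian v) (\<lambda>w. (r w)\<^sup>2)"
    and "(\<integral>w. r w \<partial>gaussian v) = 0"
    and "(\<integral>w. (r w)\<^sup>2 \<partial>gaussian v) \<le> B\<^sup>2 * l1_fourth_moment TYPE('m) * v\<^sup>2"
proof -
  let ?G = "gaussian v :: (real ^ 'm) measure"
  obtain a and b :: "real ^ 'm" where ab: "AE y in lborel. \<bar>h y - (a + b \<bullet> y)\<bar> \<le> B * (\<Sum>i\<in>UNIV. \<bar>y $ i\<bar>)\<^sup>2"
    using taylor_bound_AE[OF v hm int d d2 B] by blast
  define q where "q w = h w - (a + b \<bullet> w)" for w
  have [measurable]: "q \<in> borel_measurable borel"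
    unfolding q_def by measurable
  have q_AE: "AE w in ?G. (q w)\<^sup>2 \<le> B\<^sup>2 * (\<Sum>i\<in>UNIV. \<bar>w $ i\<bar>) ^ 4"
    unfolding AE_gaussian_iff[OF v] using ab
  proof eventually_elim
    case (elim w)
    then have "\<bar>q w\<bar>\<^sup>2 \<le> (B * (\<Sum>i\<in>UNIV. \<bar>w $ i\<bar>)\<^sup>2)\<^sup>2"
      unfolding q_def by (intro power_mono) auto
    then show ?case by (simp add: power_mult_distrib flip: power_mult)
  qed
  have bound_int: "integrable ?G (\<lambda>w. B\<^sup>2 * (\<Sum>i\<in>UNIV. \<bar>w $ i\<bar>) ^ 4)"
    by (intro integrable_mult_right integrable_gaussian_l1_power4[OF v])
  have q_sq: "integrable ?G (\<lambda>w. (q w)\<^sup>2)"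
    by (rule Bochner_Integration.integrable_bound[OF bound_int]) (use q_AE in auto)
  have h_eq: "h w = q w + (a + (\<Sum>i\<in>UNIV. b $ i * w $ i))" for w
    by (simp add: q_def inner_vec_def)
  show h_sq: "integrable ?G (\<lambda>w. (h w)\<^sup>2)"
    unfolding h_eq by (intro integrable_square_add q_sq integrable_gaussian_affine_square[OF v]) auto
  have r: "h w - (\<integral>w. h w \<partial>?G) - (\<Sum>i\<in>UNIV. (\<integral>w. h w * w $ i \<partial>?G) / v * w $ i) = r w" for w
    unfolding r_def gaussian_stein[OF v hm h_sq] by (simp add: heat_eq[OF v hm])
  note res = gaussian_affine_residual[OF v hm h_sq, unfolded r]
  show "integrable ?G r" by (rule res(2))
  show "integrable ?G (\<lambda>w. (r w)\<^sup>2)" by (rule res(1))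
  show "(\<integral>w. r w \<partial>?G) = 0" by (rule res(3))
  have "(\<integral>w. (r w)\<^sup>2 \<partial>?G) \<le> (\<integral>w. (q w)\<^sup>2 \<partial>?G)"
    unfolding q_def by (rule res)
  also have "\<dots> \<le> (\<integral>w. B\<^sup>2 * (\<Sum>i\<in>UNIV. \<bar>w $ i\<bar>) ^ 4 \<partial>?G)"
    by (rule integral_mono_AE[OF q_sq bound_int q_AE])
  also have "\<dots> = B\<^sup>2 * l1_fourth_moment TYPE('m) * v\<^sup>2"
    by (simp add: gaussian_l1_power4_scaling[OF v])
  finally show "(\<integral>w. (r w)\<^sup>2 \<partial>?G) \<le> B\<^sup>2 * l1_fourth_moment TYPE('m) * v\<^sup>2" .
qed

section \<open>Freezing lemmas and conditional expectation\<close>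

lemma (in prob_space) distr_Pair_indep:
  assumes sub: "subalgebra M G" and Y: "Y \<in> G \<rightarrow>\<^sub>M N" and Z: "Z \<in> M \<rightarrow>\<^sub>M L"
    and ind: "indep_set (sets G) {Z -` A \<inter> space M | A. A \<in> sets L}"
  shows "distr M (N \<Otimes>\<^sub>M L) (\<lambda>\<omega>. (Y \<omega>, Z \<omega>)) = distr M N Y \<Otimes>\<^sub>M distr M L Z"
proof -
  have sp: "space G = space M" and GM: "sets G \<subseteq> sets M"
    using sub by (auto simp: subalgebra_def)
  have YM: "Y \<in> M \<rightarrow>\<^sub>M N"
    by (rule measurable_from_subalg[OF sub Y])
  interpret Y: prob_space "distr M N Y" by (rule prob_space_distr[OF YM])
  interpret Z: prob_space "distr M L Z" by (rule prob_space_distr[OF Z])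
  have YZ: "(\<lambda>\<omega>. (Y \<omega>, Z \<omega>)) \<in> M \<rightarrow>\<^sub>M N \<Otimes>\<^sub>M L"
    using YM Z by simp
  show ?thesis
  proof (rule pair_measure_eqI[symmetric])
    show "sigma_finite_measure (distr M N Y)" "sigma_finite_measure (distr M L Z)"
      by unfold_locales
    fix A B assume AB: "A \<in> sets (distr M N Y)" "B \<in> sets (distr M L Z)"
    have "Y -` A \<inter> space M \<in> sets G"
      using measurable_sets[OF Y, of A] AB by (simp add: sp)
    moreover have "Z -` B \<inter> space M \<in> {Z -` A \<inter> space M | A. A \<in> sets L}"
      using AB by auto
    ultimately have "prob ((Y -` A \<inter> space M) \<inter> (Z -` B \<inter> space M)) = prob (Y -` A \<inter> space M) * prob (Z -` B \<inter> space M)"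
      using ind unfolding indep_sets2_eq by blast
    moreover have "(\<lambda>\<omega>. (Y \<omega>, Z \<omega>)) -` (A \<times> B) \<inter> space M = (Y -` A \<inter> space M) \<inter> (Z -` B \<inter> space M)"
      by auto
    ultimately show "emeasure (distr M N Y) A * emeasure (distr M L Z) B
        = emeasure (distr M (N \<Otimes>\<^sub>M L) (\<lambda>\<omega>. (Y \<omega>, Z \<omega>))) (A \<times> B)"
      using AB YM Z YZ by (simp add: emeasure_distr emeasure_eq_measure ennreal_mult)
  qed simp
qed

text \<open>Known information \<open>Y\<close> may be held fixed while the independent noise \<open>Z\<close> is integrated out: the
  joint law of the two is a product measure.\<close>

lemma (in prob_space) nn_integral_freezing:
  assumes sub: "subalgebra M G" and Y: "Y \<in> G \<rightarrow>\<^sub>M N" and Z: "Z \<in> M \<rightarrow>\<^sub>M L"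
    and ind: "indep_set (sets G) {Z -` A \<inter> space M | A. A \<in> sets L}"
    and g [measurable]: "g \<in> borel_measurable (N \<Otimes>\<^sub>M L)"
  shows "(\<integral>\<^sup>+\<omega>. g (Y \<omega>, Z \<omega>) \<partial>M) = (\<integral>\<^sup>+\<omega>. \<integral>\<^sup>+z. g (Y \<omega>, z) \<partial>distr M L Z \<partial>M)"
proof -
  have YM [measurable]: "Y \<in> M \<rightarrow>\<^sub>M N"
    by (rule measurable_from_subalg[OF sub Y])
  note [measurable] = Z
  interpret Z: prob_space "distr M L Z" by (rule prob_space_distr[OF Z])
  have "(\<integral>\<^sup>+\<omega>. g (Y \<omega>, Z \<omega>) \<partial>M) = (\<integral>\<^sup>+p. g p \<partial>distr M (N \<Otimes>\<^sub>M L) (\<lambda>\<omega>. (Y \<omega>, Z \<omega>)))"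
    by (subst nn_integral_distr) auto
  also have "\<dots> = (\<integral>\<^sup>+p. g p \<partial>(distr M N Y \<Otimes>\<^sub>M distr M L Z))"
    by (simp add: distr_Pair_indep[OF sub Y Z ind])
  also have "\<dots> = (\<integral>\<^sup>+y. \<integral>\<^sup>+z. g (y, z) \<partial>distr M L Z \<partial>distr M N Y)"
    by (rule Z.nn_integral_fst[symmetric]) measurable
  also have "\<dots> = (\<integral>\<^sup>+\<omega>. \<integral>\<^sup>+z. g (Y \<omega>, z) \<partial>distr M L Z \<partial>M)"
  proof (rule nn_integral_distr[OF YM])
    show "(\<lambda>y. \<integral>\<^sup>+z. g (y, z) \<partial>distr M L Z) \<in> borel_measurable (distr M N Y)"
      using Z.borel_measurable_nn_integral[of "\<lambda>y z. g (y, z)" N] by simp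
  qed
  finally show ?thesis .
qed

lemma (in prob_space) integral_freezing:
  fixes g :: "_ \<Rightarrow> real"
  assumes sub: "subalgebra M G" and Y: "Y \<in> G \<rightarrow>\<^sub>M N" and Z: "Z \<in> M \<rightarrow>\<^sub>M L"
    and ind: "indep_set (sets G) {Z -` A \<inter> space M | A. A \<in> sets L}"
    and g [measurable]: "g \<in> borel_measurable (N \<Otimes>\<^sub>M L)"
    and int: "integrable M (\<lambda>\<omega>. g (Y \<omega>, Z \<omega>))"
  shows "integrable M (\<lambda>\<omega>. \<integral>z. g (Y \<omega>, z) \<partial>distr M L Z)"
    and "(\<integral>\<omega>. g (Y \<omega>, Z \<omega>) \<partial>M) = (\<integral>\<omega>. \<integral>z. g (Y \<omega>, z) \<partial>distr M L Z \<partial>M)"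
proof -
  have YM [measurable]: "Y \<in> M \<rightarrow>\<^sub>M N"
    by (rule measurable_from_subalg[OF sub Y])
  note [measurable] = Z
  interpret Z: prob_space "distr M L Z" by (rule prob_space_distr[OF Z])
  interpret Y: prob_space "distr M N Y" by (rule prob_space_distr[OF YM])
  interpret P: pair_prob_space "distr M N Y" "distr M L Z" ..
  note D = distr_Pair_indep[OF sub Y Z ind]
  have "integrable (distr M (N \<Otimes>\<^sub>M L) (\<lambda>\<omega>. (Y \<omega>, Z \<omega>))) g"
    using int by (subst integrable_distr_eq) auto
  then have gint: "integrable (distr M N Y \<Otimes>\<^sub>M distr M L Z) g"
    by (simp add: D)
  have m: "(\<lambda>y. \<integral>z. g (y, z) \<partial>distr M L Z) \<in> borel_measurable N"
    by (rule Z.borel_measurable_lebesgue_integral) simp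
  have "integrable (distr M N Y) (\<lambda>y. \<integral>z. g (y, z) \<partial>distr M L Z)"
    by (rule P.integrable_fst'[OF gint])
  then show "integrable M (\<lambda>\<omega>. \<integral>z. g (Y \<omega>, z) \<partial>distr M L Z)"
    using m by (subst (asm) integrable_distr_eq) auto
  have "(\<integral>\<omega>. g (Y \<omega>, Z \<omega>) \<partial>M) = (\<integral>p. g p \<partial>distr M (N \<Otimes>\<^sub>M L) (\<lambda>\<omega>. (Y \<omega>, Z \<omega>)))"
    by (subst integral_distr) auto
  also have "\<dots> = (\<integral>y. \<integral>z. g (y, z) \<partial>distr M L Z \<partial>distr M N Y)"
    unfolding D by (rule P.integral_fst'[OF gint, symmetric])
  also have "\<dots> = (\<integral>\<omega>. \<integral>z. g (Y \<omega>, z) \<partial>distr M L Z \<partial>M)"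
    using m by (subst integral_distr) auto
  finally show "(\<integral>\<omega>. g (Y \<omega>, Z \<omega>) \<partial>M) = (\<integral>\<omega>. \<integral>z. g (Y \<omega>, z) \<partial>distr M L Z \<partial>M)" .
qed

text \<open>The defining identity on an event \<open>A\<close> is the plain freezing lemma for the enlarged known
  information consisting of \<open>Y\<close> and the indicator of \<open>A\<close>.\<close>

lemma (in prob_space) real_cond_exp_freezing:
  fixes g :: "_ \<Rightarrow> real"
  assumes sub: "subalgebra M G" and Y: "Y \<in> G \<rightarrow>\<^sub>M N" and Z: "Z \<in> M \<rightarrow>\<^sub>M L"
    and ind: "indep_set (sets G) {Z -` A \<inter> space M | A. A \<in> sets L}"
    and g [measurable]: "g \<in> borel_measurable (N \<Otimes>\<^sub>M L)"
    and int: "integrable M (\<lambda>\<omega>. g (Y \<omega>, Z \<omega>))"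
  shows "AE \<omega> in M. real_cond_exp M G (\<lambda>\<omega>. g (Y \<omega>, Z \<omega>)) \<omega> = (\<integral>z. g (Y \<omega>, z) \<partial>distr M L Z)"
proof -
  interpret S: finite_measure_subalgebra M G
    by unfold_locales (rule sub)
  interpret Z: prob_space "distr M L Z" by (rule prob_space_distr[OF Z])
  have m: "(\<lambda>y. \<integral>z. g (y, z) \<partial>distr M L Z) \<in> borel_measurable N"
    by (rule Z.borel_measurable_lebesgue_integral) simp
  show ?thesis
  proof (rule S.real_cond_exp_charact)
    show "integrable M (\<lambda>\<omega>. g (Y \<omega>, Z \<omega>))" by fact
    show "integrable M (\<lambda>\<omega>. \<integral>z. g (Y \<omega>, z) \<partial>distr M L Z)"
      by (rule integral_freezing(1)[OF sub Y Z ind g int])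
    show "(\<lambda>\<omega>. \<integral>z. g (Y \<omega>, z) \<partial>distr M L Z) \<in> borel_measurable G"
      by (rule measurable_compose[OF Y m])
    fix A assume A: "A \<in> sets G"
    then have AM: "A \<in> sets M" using sub by (auto simp: subalgebra_def)
    let ?Y = "\<lambda>\<omega>. (indicator A \<omega> :: real, Y \<omega>)" and ?g = "\<lambda>p. fst (fst p) * g (snd (fst p), snd p)"
    have Y': "?Y \<in> G \<rightarrow>\<^sub>M borel \<Otimes>\<^sub>M N"
      using A Y by simp
    have g': "?g \<in> borel_measurable ((borel \<Otimes>\<^sub>M N) \<Otimes>\<^sub>M L)"
      by measurable
    have int': "integrable M (\<lambda>\<omega>. ?g (?Y \<omega>, Z \<omega>))"
      using integrable_mult_indicator[OF AM int] by simp
    show "(\<integral>\<omega>\<in>A. g (Y \<omega>, Z \<omega>) \<partial>M) = (\<integral>\<omega>\<in>A. (\<integral>z. g (Y \<omega>, z) \<partial>distr M L Z) \<partial>M)"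
      using integral_freezing(2)[OF sub Y' Z ind g' int'] by (simp add: set_lebesgue_integral_def)
  qed
qed

text \<open>The product \<open>c g\<close> may fail to be integrable, as can occur for \<open>f(X) \<Delta>\<^sub>jW\<close>.  The identity
  survives because the conditional expectations of the positive and the negative part of \<open>c g\<close> are
  combinations of those of \<open>g\<close>, which are finite almost everywhere.\<close>

lemma (in sigma_finite_subalgebra) real_cond_exp_mult_measurable:
  assumes c [measurable]: "c \<in> borel_measurable F" and g: "integrable M g"
  shows "AE x in M. real_cond_exp M F (\<lambda>x. c x * g x) x = c x * real_cond_exp M F g x"
proof -
  have [measurable]: "g \<in> borel_measurable M" using g by simp
  have [measurable]: "c \<in> borel_measurable M" by (rule measurable_from_subalg[OF subalg c])
  have ennreal_mult_signed: "ennreal (a * b) = ennreal a * ennreal b + ennreal (- a) * ennreal (- b)" for a b :: real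
    by (cases "a \<ge> 0"; cases "b \<ge> 0")
      (simp_all add: ennreal_neg mult_nonneg_nonpos mult_nonpos_nonneg flip: ennreal_mult)
  have fin: "AE x in M. nn_cond_exp M F (\<lambda>x. ennreal (k x)) x \<noteq> \<infinity>" if k: "integrable M k" for k
  proof (rule nn_integral_PInf_AE)
    have "(\<integral>\<^sup>+x. 1 * nn_cond_exp M F (\<lambda>x. ennreal (k x)) x \<partial>M) = (\<integral>\<^sup>+x. 1 * ennreal (k x) \<partial>M)"
      using k by (intro nn_cond_exp_intg) auto
    then show "(\<integral>\<^sup>+x. nn_cond_exp M F (\<lambda>x. ennreal (k x)) x \<partial>M) \<noteq> \<infinity>"
      using integrableD(2)[OF k] by simp
  qed simp
  have prod: "AE x in M. nn_cond_exp M F (\<lambda>x. ennreal (d x * g x)) x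
      = ennreal (d x) * nn_cond_exp M F (\<lambda>x. ennreal (g x)) x + ennreal (- d x) * nn_cond_exp M F (\<lambda>x. ennreal (- g x)) x"
    if d [measurable]: "d \<in> borel_measurable F" for d
  proof -
    have [measurable]: "d \<in> borel_measurable M" by (rule measurable_from_subalg[OF subalg d])
    have "AE x in M. ennreal (d x) * nn_cond_exp M F (\<lambda>x. ennreal (g x)) x = nn_cond_exp M F (\<lambda>x. ennreal (d x) * ennreal (g x)) x"
      by (rule nn_cond_exp_prod) auto
    moreover have "AE x in M. ennreal (- d x) * nn_cond_exp M F (\<lambda>x. ennreal (- g x)) x = nn_cond_exp M F (\<lambda>x. ennreal (- d x) * ennreal (- g x)) x"
      by (rule nn_cond_exp_prod) auto
    moreover have "AE x in M. nn_cond_exp M F (\<lambda>x. ennreal (d x) * ennreal (g x)) x + nn_cond_exp M F (\<lambda>x. ennreal (- d x) * ennreal (- g x)) x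
        = nn_cond_exp M F (\<lambda>x. ennreal (d x) * ennreal (g x) + ennreal (- d x) * ennreal (- g x)) x"
      by (rule nn_cond_exp_sum) auto
    ultimately show ?thesis
      by eventually_elim (simp add: ennreal_mult_signed)
  qed
  have "AE x in M. nn_cond_exp M F (\<lambda>x. ennreal (- (c x * g x))) x
      = ennreal (- c x) * nn_cond_exp M F (\<lambda>x. ennreal (g x)) x + ennreal (c x) * nn_cond_exp M F (\<lambda>x. ennreal (- g x)) x"
    using prod[of "\<lambda>x. - c x"] by simp
  moreover have "AE x in M. nn_cond_exp M F (\<lambda>x. ennreal (- g x)) x \<noteq> \<infinity>"
    using g by (intro fin) simp
  ultimately show ?thesis
    using prod[OF c] fin[OF g]
  proof eventually_elim
    case (elim x)
    obtain p where p: "nn_cond_exp M F (\<lambda>x. ennreal (g x)) x = ennreal p" "p \<ge> 0"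
      using elim by (cases "nn_cond_exp M F (\<lambda>x. ennreal (g x)) x" rule: ennreal_cases) auto
    obtain n where n: "nn_cond_exp M F (\<lambda>x. ennreal (- g x)) x = ennreal n" "n \<ge> 0"
      using elim by (cases "nn_cond_exp M F (\<lambda>x. ennreal (- g x)) x" rule: ennreal_cases) auto
    show ?case
    proof (cases "c x \<ge> 0")
      case True
      then show ?thesis
        using elim p n by (simp add: real_cond_exp_def ennreal_neg algebra_simps flip: ennreal_mult)
    next
      case False
      then have "0 \<le> - c x * p" "0 \<le> - c x * n" using p n by (simp_all add: mult_nonpos_nonneg)
      moreover have "nn_cond_exp M F (\<lambda>x. ennreal (c x * g x)) x = ennreal (- c x * n)"
          "nn_cond_exp M F (\<lambda>x. ennreal (- (c x * g x))) x = ennreal (- c x * p)"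
        using elim p n False by (simp_all add: ennreal_neg flip: ennreal_mult)
      ultimately show ?thesis
        using p n by (simp add: real_cond_exp_def algebra_simps del: mult_minus_left)
    qed
  qed
qed

section \<open>The Euler scheme along a Brownian motion\<close>

locale brownian_euler = prob_space M
  for M :: "'a measure" and F :: "real \<Rightarrow> 'a measure" and T :: real
    and W :: "real \<Rightarrow> 'a \<Rightarrow> real ^ 'm"
    and \<mu> :: "real ^ 'd \<Rightarrow> real ^ 'd" and \<sigma> :: "real ^ 'd \<Rightarrow> real ^ 'm ^ 'd"
    and f :: "real ^ 'd \<Rightarrow> real" and J :: nat +
  assumes T_pos: "T > 0" and filtration: "filtration_on M T F" and brownian: "brownian_motion M T F W"
    and \<mu>_measurable [measurable]: "\<mu> \<in> borel \<rightarrow>\<^sub>M borel" and \<sigma>_measurable [measurable]: "\<sigma> \<in> borel \<rightarrow>\<^sub>M borel"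
    and f_measurable [measurable]: "f \<in> borel_measurable borel"
    and J_pos: "J \<ge> 1"
    and terminal_integrable: "\<And>j x. j < J \<Longrightarrow> integrable M (\<lambda>\<omega>. f (euler T \<mu> \<sigma> W J j x J \<omega>))"
begin

abbreviation "\<Delta> \<equiv> step T J"
abbreviation "X \<equiv> euler T \<mu> \<sigma> W J"
abbreviation "dW \<equiv> incr T W J"
abbreviation "\<F> j \<equiv> F (grid T J j)"
abbreviation "u \<equiv> u_back T \<mu> \<sigma> f J"

definition after_step :: "nat \<Rightarrow> real ^ 'd \<Rightarrow> real ^ 'm \<Rightarrow> real" where
  "after_step n x w = u n (euler_map \<mu> \<sigma> \<Delta> x w)"

lemma step_pos: "\<Delta> > 0"
  using T_pos J_pos by (simp add: step_def)

lemma grid_in: "j \<le> J \<Longrightarrow> grid T J j \<in> {0..T}"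
  using T_pos J_pos by (auto simp: grid_def step_def field_simps)

lemma grid_mono: "i \<le> j \<Longrightarrow> grid T J i \<le> grid T J j"
  using step_pos by (simp add: grid_def mult_right_mono)

lemma grid_diff: "1 \<le> j \<Longrightarrow> grid T J j - grid T J (j - 1) = \<Delta>"
  by (simp add: grid_def of_nat_diff algebra_simps)

lemma subalgebra_grid: "j \<le> J \<Longrightarrow> subalgebra M (\<F> j)"
  using filtration grid_in by (auto simp: filtration_on_def)

lemma subalgebra_grid_mono:
  assumes "i \<le> j" "j \<le> J" shows "subalgebra (\<F> j) (\<F> i)"
proof -
  have "space (\<F> i) = space (\<F> j)"
    using subalgebra_grid[of i] subalgebra_grid[of j] assms by (auto simp: subalgebra_def)
  moreover have "sets (\<F> i) \<subseteq> sets (\<F> j)"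
    using filtration grid_in[of i] grid_in[of j] grid_mono[of i j] assms unfolding filtration_on_def by auto
  ultimately show ?thesis by (simp add: subalgebra_def)
qed

lemma incr_adapted:
  assumes "1 \<le> j" "j \<le> J" shows "dW j \<in> \<F> j \<rightarrow>\<^sub>M borel"
proof -
  have "W (grid T J j) \<in> \<F> j \<rightarrow>\<^sub>M borel" "W (grid T J (j - 1)) \<in> \<F> (j - 1) \<rightarrow>\<^sub>M borel"
    using brownian grid_in[of j] grid_in[of "j - 1"] assms by (auto simp: brownian_motion_def)
  moreover have "W (grid T J (j - 1)) \<in> \<F> j \<rightarrow>\<^sub>M borel"
    by (rule measurable_from_subalg[OF subalgebra_grid_mono calculation(2)]) (use assms in auto)
  ultimately have "(\<lambda>\<omega>. W (grid T J j) \<omega> - W (grid T J (j - 1)) \<omega>) \<in> \<F> j \<rightarrow>\<^sub>M borel"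
    by simp
  then show ?thesis by (simp add: incr_def[abs_def])
qed

lemma incr_measurable: "1 \<le> j \<Longrightarrow> j \<le> J \<Longrightarrow> dW j \<in> M \<rightarrow>\<^sub>M borel"
  by (rule measurable_from_subalg[OF subalgebra_grid incr_adapted])

lemma incr_gaussian_indep:
  assumes "1 \<le> j" "j \<le> J"
  shows "distr M borel (dW j) = gaussian \<Delta>"
    and "indep_set (sets (\<F> (j - 1))) {dW j -` A \<inter> space M | A. A \<in> sets borel}"
proof -
  have "grid T J (j - 1) < grid T J j"
    using grid_diff[of j] step_pos assms by simp
  then have "distr M borel (\<lambda>\<omega>. W (grid T J j) \<omega> - W (grid T J (j - 1)) \<omega>) = gaussian (grid T J j - grid T J (j - 1)) \<and>
      indep_set (sets (\<F> (j - 1))) {(\<lambda>\<omega>. W (grid T J j) \<omega> - W (grid T J (j - 1)) \<omega>) -` A \<inter> space M | A. A \<in> sets borel}"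
    using brownian grid_in[of j] grid_in[of "j - 1"] assms unfolding brownian_motion_def by auto
  then show "distr M borel (dW j) = gaussian \<Delta>"
    and "indep_set (sets (\<F> (j - 1))) {dW j -` A \<inter> space M | A. A \<in> sets borel}"
    unfolding grid_diff[OF assms(1)] by (simp_all add: incr_def[abs_def])
qed

lemma euler_map_measurable [measurable]:
  "(\<lambda>p. euler_map \<mu> \<sigma> \<Delta> (fst p) (snd p)) \<in> borel \<Otimes>\<^sub>M borel \<rightarrow>\<^sub>M borel"
proof -
  have "continuous_on UNIV (\<lambda>q :: (real ^ 'm ^ 'd) \<times> (real ^ 'm). fst q *v snd q)"
    unfolding matrix_vector_mult_def by (intro continuous_intros)
  then have "(\<lambda>q :: (real ^ 'm ^ 'd) \<times> (real ^ 'm). fst q *v snd q) \<in> borel \<Otimes>\<^sub>M borel \<rightarrow>\<^sub>M borel"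
    unfolding borel_prod by (rule borel_measurable_continuous_onI)
  from measurable_compose[OF _ this, of "\<lambda>p. (\<sigma> (fst p), snd p)"]
  have [measurable]: "(\<lambda>p. \<sigma> (fst p) *v snd p) \<in> borel \<Otimes>\<^sub>M borel \<rightarrow>\<^sub>M borel"
    by simp
  show ?thesis unfolding euler_map_def by measurable
qed

lemma u_measurable [measurable]: "u n \<in> borel_measurable borel"
proof (induction n)
  case (Suc n)
  note [measurable] = Suc
  interpret N: prob_space "gaussian 1 :: (real ^ 'm) measure" by (rule prob_space_gaussian) simp
  have "(\<lambda>p. euler_map \<mu> \<sigma> \<Delta> (fst p) (sqrt \<Delta> *\<^sub>R snd p)) \<in> borel \<Otimes>\<^sub>M gaussian 1 \<rightarrow>\<^sub>M borel"
    using measurable_compose[OF _ euler_map_measurable, of "\<lambda>p. (fst p, sqrt \<Delta> *\<^sub>R snd p)" "borel \<Otimes>\<^sub>M gaussian 1"]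
    by simp
  from measurable_compose[OF this Suc]
  have "(\<lambda>x. \<integral>z. u n (euler_map \<mu> \<sigma> \<Delta> x (sqrt \<Delta> *\<^sub>R z)) \<partial>gaussian 1) \<in> borel_measurable borel"
    by (intro N.borel_measurable_lebesgue_integral) (simp add: case_prod_beta)
  then show ?case by simp
qed simp

lemma after_step_measurable_pair [measurable]: "(\<lambda>p. after_step n (fst p) (snd p)) \<in> borel_measurable (borel \<Otimes>\<^sub>M borel)"
  unfolding after_step_def by measurable

lemma after_step_measurable [measurable]: "after_step n x \<in> borel_measurable borel"
  using measurable_compose[OF _ after_step_measurable_pair, of "\<lambda>w. (x, w)" borel n] by simp

lemma u_Suc_heat: "u (Suc n) x = heat \<Delta> (after_step n x) 0"
  by (simp add: heat_def after_step_def)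

lemma u_Suc: "u (Suc n) x = (\<integral>w. after_step n x w \<partial>gaussian \<Delta>)"
  unfolding u_Suc_heat using heat_eq[OF step_pos, of "after_step n x" 0] by simp

text \<open>Between two grid points \<open>u\<^sub>\<Delta>\<close> is a heat flow in its last argument; \<open>s\<close> is the time left to the
  next grid point.\<close>

lemma u_fun_heat:
  assumes j: "1 \<le> j" "j \<le> J" and s: "0 < s" "s \<le> \<Delta>"
  shows "u_fun T \<mu> \<sigma> f J (grid T J j - s) x = heat s (after_step (J - j) x)"
proof -
  have "(grid T J j - s) / \<Delta> = real j - s / \<Delta>"
    using step_pos by (simp add: grid_def field_simps)
  moreover have "0 < s / \<Delta>" "s / \<Delta> \<le> 1" using s step_pos by auto
  ultimately have "\<lfloor>(grid T J j - s) / \<Delta>\<rfloor> = int j - 1"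
    by (intro floor_unique) auto
  then have "nat \<lfloor>(grid T J j - s) / \<Delta>\<rfloor> + 1 = j" using j by simp
  moreover have "grid T J j - s \<noteq> T" using grid_in[OF j(2)] s by simp
  ultimately show ?thesis
    by (intro ext) (simp only: u_fun_def Let_def if_False heat_def after_step_def, simp)
qed

lemma euler_start: "l \<le> j \<Longrightarrow> X j x l \<omega> = x"
  by (cases l) auto

lemma euler_step: "j < l \<Longrightarrow> X j x l \<omega> = euler_map \<mu> \<sigma> \<Delta> (X j x (l - 1) \<omega>) (dW l \<omega>)"
  by (cases l) auto

lemma after_step_euler: "j < l \<Longrightarrow> after_step n (X j x (l - 1) \<omega>) (dW l \<omega>) = u n (X j x l \<omega>)"
  by (simp only: after_step_def euler_step)

lemma euler_adapted: "l \<le> J \<Longrightarrow> X j x l \<in> \<F> l \<rightarrow>\<^sub>M borel"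
proof (induction l)
  case 0
  then show ?case by (simp add: euler.simps(1)[abs_def])
next
  case (Suc l)
  show ?case
  proof (cases "Suc l \<le> j")
    case True
    then have "X j x (Suc l) = (\<lambda>_. x)" by (intro ext euler_start)
    then show ?thesis by simp
  next
    case False
    have "X j x l \<in> \<F> (Suc l) \<rightarrow>\<^sub>M borel"
      using Suc by (intro measurable_from_subalg[OF subalgebra_grid_mono[of l "Suc l"]]) auto
    moreover have "dW (Suc l) \<in> \<F> (Suc l) \<rightarrow>\<^sub>M borel"
      using Suc by (intro incr_adapted) auto
    ultimately have "(\<lambda>\<omega>. (X j x l \<omega>, dW (Suc l) \<omega>)) \<in> \<F> (Suc l) \<rightarrow>\<^sub>M borel \<Otimes>\<^sub>M borel"
      by (rule measurable_Pair)
    from measurable_compose[OF this euler_map_measurable]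
    have "(\<lambda>\<omega>. euler_map \<mu> \<sigma> \<Delta> (X j x l \<omega>) (dW (Suc l) \<omega>)) \<in> \<F> (Suc l) \<rightarrow>\<^sub>M borel"
      by simp
    moreover have "X j x (Suc l) = (\<lambda>\<omega>. euler_map \<mu> \<sigma> \<Delta> (X j x l \<omega>) (dW (Suc l) \<omega>))"
      using False by (intro ext) simp
    ultimately show ?thesis by simp
  qed
qed

text \<open>The backward recursion computes the martingale \<open>E[f(X) | F]\<close> along the scheme: one step
  backwards is the tower property followed by the freezing lemma.  Integrability comes along with the
  identification, so it need not be known beforehand that the integrals defining \<open>u\<close> exist.\<close>

lemma cond_exp_terminal:
  assumes j: "j < J" and n: "n \<le> J - j"
  shows "integrable M (\<lambda>\<omega>. u n (X j x (J - n) \<omega>)) \<and>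
    (AE \<omega> in M. real_cond_exp M (\<F> (J - n)) (\<lambda>\<omega>. f (X j x J \<omega>)) \<omega> = u n (X j x (J - n) \<omega>))"
  using n
proof (induction n)
  case 0
  interpret S: finite_measure_subalgebra M "\<F> J"
    by unfold_locales (rule subalgebra_grid, simp)
  have "(\<lambda>\<omega>. f (X j x J \<omega>)) \<in> borel_measurable (\<F> J)"
    by (rule measurable_compose[OF euler_adapted f_measurable]) simp
  then show ?case
    using terminal_integrable[OF j] by auto
next
  case (Suc n)
  define k where "k = J - n"
  have k: "1 \<le> k" "k \<le> J" "j < k" "J - Suc n = k - 1" using Suc j by (auto simp: k_def)
  interpret S: finite_measure_subalgebra M "\<F> (k - 1)"
    by unfold_locales (rule subalgebra_grid, use k in auto)
  interpret S': finite_measure_subalgebra M "\<F> k"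
    by unfold_locales (rule subalgebra_grid, use k in auto)
  have IH: "integrable M (\<lambda>\<omega>. u n (X j x k \<omega>))"
      "AE \<omega> in M. real_cond_exp M (\<F> k) (\<lambda>\<omega>. f (X j x J \<omega>)) \<omega> = u n (X j x k \<omega>)"
    using Suc by (auto simp: k_def)
  let ?fX = "\<lambda>\<omega>. f (X j x J \<omega>)"
  have fX: "integrable M ?fX" by (rule terminal_integrable[OF j])
  have 1: "AE \<omega> in M. real_cond_exp M (\<F> (k - 1)) (real_cond_exp M (\<F> k) ?fX) \<omega> = real_cond_exp M (\<F> (k - 1)) ?fX \<omega>"
    using k by (intro S.real_cond_exp_nested_subalg subalgebra_grid subalgebra_grid_mono fX) auto
  have 2: "AE \<omega> in M. real_cond_exp M (\<F> (k - 1)) (real_cond_exp M (\<F> k) ?fX) \<omega>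
      = real_cond_exp M (\<F> (k - 1)) (\<lambda>\<omega>. u n (X j x k \<omega>)) \<omega>"
    using IH(1) by (intro S.real_cond_exp_cong IH(2)) auto
  let ?g = "\<lambda>p. after_step n (fst p) (snd p)"
  have g_eq: "?g (X j x (k - 1) \<omega>, dW k \<omega>) = u n (X j x k \<omega>)" for \<omega>
    using after_step_euler[OF k(3)] by simp
  have g_int: "integrable M (\<lambda>\<omega>. ?g (X j x (k - 1) \<omega>, dW k \<omega>))"
    unfolding g_eq by (rule IH)
  have Y: "X j x (k - 1) \<in> \<F> (k - 1) \<rightarrow>\<^sub>M borel"
    using k by (intro euler_adapted) auto
  note fr = subalgebra_grid[of "k - 1"] Y incr_measurable[OF k(1,2)] incr_gaussian_indep(2)[OF k(1,2)] after_step_measurable_pair g_int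
  have inner: "(\<integral>z. ?g (X j x (k - 1) \<omega>, z) \<partial>distr M borel (dW k)) = u (Suc n) (X j x (k - 1) \<omega>)" for \<omega>
    unfolding incr_gaussian_indep(1)[OF k(1,2)] u_Suc by simp
  have 3: "AE \<omega> in M. real_cond_exp M (\<F> (k - 1)) (\<lambda>\<omega>. u n (X j x k \<omega>)) \<omega> = u (Suc n) (X j x (k - 1) \<omega>)"
    using real_cond_exp_freezing[OF fr] k unfolding inner g_eq by simp
  have "integrable M (\<lambda>\<omega>. u (Suc n) (X j x (k - 1) \<omega>))"
    using integral_freezing(1)[OF fr] k unfolding inner by simp
  moreover from 1 2 3 have "AE \<omega> in M. real_cond_exp M (\<F> (k - 1)) ?fX \<omega> = u (Suc n) (X j x (k - 1) \<omega>)"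
    by eventually_elim simp
  ultimately show ?case unfolding k(4) by blast
qed

text \<open>This holds for every \<open>x\<close>, not just for almost every value of the scheme, because the scheme may
  be started at the preceding grid point in an arbitrary \<open>x\<close>.\<close>

lemma after_step_integrable:
  assumes j: "1 \<le> j" "j \<le> J"
  shows "integrable (gaussian \<Delta>) (after_step (J - j) x)"
proof -
  have "integrable M (\<lambda>\<omega>. u (J - j) (X (j - 1) x j \<omega>))"
    using cond_exp_terminal[of "j - 1" "J - j" x] j by auto
  moreover have "u (J - j) (X (j - 1) x j \<omega>) = after_step (J - j) x (dW j \<omega>)" for \<omega>
    using after_step_euler[of "j - 1" j "J - j" x \<omega>] euler_start[of "j - 1" "j - 1" x \<omega>] j by simp
  ultimately have "integrable M (\<lambda>\<omega>. after_step (J - j) x (dW j \<omega>))" by simp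
  then have "integrable (distr M borel (dW j)) (after_step (J - j) x)"
    using incr_measurable[OF j] by (subst integrable_distr_eq) auto
  then show ?thesis by (simp only: incr_gaussian_indep(1)[OF j])
qed

end

section \<open>Variance of the residual\<close>

text \<open>The bound \<open>B\<close> is a parameter rather than an existential, so that one value can be shared by the
  schemes with all numbers of steps.\<close>

locale smooth_brownian_euler = brownian_euler M F T W \<mu> \<sigma> f J
  for M :: "'a measure" and F :: "real \<Rightarrow> 'a measure" and T :: real
    and W :: "real \<Rightarrow> 'a \<Rightarrow> real ^ 'm"
    and \<mu> :: "real ^ 'd \<Rightarrow> real ^ 'd" and \<sigma> :: "real ^ 'd \<Rightarrow> real ^ 'm ^ 'd"
    and f :: "real ^ 'd \<Rightarrow> real" and J :: nat +
  fixes B :: real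
  assumes first_derivs: "\<And>t i x y. 0 \<le> t \<Longrightarrow> t < T \<Longrightarrow> partial_differentiable i (u_fun T \<mu> \<sigma> f J t x) y"
    and second_derivs: "\<And>t i k x y. 0 \<le> t \<Longrightarrow> t < T \<Longrightarrow> partial_differentiable k (partial_deriv i (u_fun T \<mu> \<sigma> f J t x)) y"
    and second_derivs_bound: "\<And>t i k x y. 0 \<le> t \<Longrightarrow> t < T \<Longrightarrow> \<bar>partial_deriv k (partial_deriv i (u_fun T \<mu> \<sigma> f J t x)) y\<bar> \<le> B"
begin

definition residual :: "nat \<Rightarrow> real ^ 'd \<Rightarrow> real ^ 'm \<Rightarrow> real" where
  "residual j x w = after_step (J - j) x w - heat \<Delta> (after_step (J - j) x) 0
     - (\<Sum>i\<in>UNIV. partial_deriv i (heat \<Delta> (after_step (J - j) x)) 0 * w $ i)"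

lemma second_moment_const_nonneg: "0 \<le> B\<^sup>2 * l1_fourth_moment TYPE('m)"
  unfolding l1_fourth_moment_def
  by (intro mult_nonneg_nonneg Bochner_Integration.integral_nonneg) (auto simp: sum_nonneg)

lemma heat_after_step_derivs:
  assumes j: "1 \<le> j" "j \<le> J" and s: "0 < s" "s < \<Delta>"
  shows "partial_differentiable i (heat s (after_step (J - j) x)) y"
    and "partial_differentiable k (partial_deriv i (heat s (after_step (J - j) x))) y"
    and "\<bar>partial_deriv k (partial_deriv i (heat s (after_step (J - j) x))) y\<bar> \<le> B"
proof -
  have "0 \<le> grid T J j - s"
  proof -
    have "0 \<le> grid T J (j - 1)" using grid_in[of "j - 1"] j by auto
    then show ?thesis using grid_diff[OF j(1)] s by linarith
  qed
  moreover have "grid T J j - s < T"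
    using grid_in[OF j(2)] s by simp
  moreover have "u_fun T \<mu> \<sigma> f J (grid T J j - s) x = heat s (after_step (J - j) x)"
    using j s by (intro u_fun_heat) auto
  ultimately show "partial_differentiable i (heat s (after_step (J - j) x)) y"
    "partial_differentiable k (partial_deriv i (heat s (after_step (J - j) x))) y"
    "\<bar>partial_deriv k (partial_deriv i (heat s (after_step (J - j) x))) y\<bar> \<le> B"
    using first_derivs[of "grid T J j - s" i x y] second_derivs[of "grid T J j - s" k i x y]
      second_derivs_bound[of "grid T J j - s" k i x y] by simp_all
qed

lemma residual_facts:
  assumes j: "1 \<le> j" "j \<le> J"
  shows after_step_square_integrable: "integrable (gaussian \<Delta>) (\<lambda>w. (after_step (J - j) x w)\<^sup>2)"
    and residual_integrable: "integrable (gaussian \<Delta>) (residual j x)"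
    and residual_square_integrable: "integrable (gaussian \<Delta>) (\<lambda>w. (residual j x w)\<^sup>2)"
    and residual_mean: "(\<integral>w. residual j x w \<partial>gaussian \<Delta>) = 0"
    and residual_variance: "(\<integral>w. (residual j x w)\<^sup>2 \<partial>gaussian \<Delta>) \<le> B\<^sup>2 * l1_fourth_moment TYPE('m) * \<Delta>\<^sup>2"
  using heat_residual_bound[OF step_pos after_step_measurable after_step_integrable[OF j]
      heat_after_step_derivs(1)[OF j] heat_after_step_derivs(2)[OF j] heat_after_step_derivs(3)[OF j], of x]
  by (simp_all add: residual_def[abs_def])

lemma gradient_formula:
  assumes j: "1 \<le> j" "j \<le> J"
  shows "partial_deriv i (heat \<Delta> (after_step (J - j) x)) 0 = (\<integral>w. after_step (J - j) x w * w $ i \<partial>gaussian \<Delta>) / \<Delta>"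
  by (rule gaussian_stein[OF step_pos after_step_measurable after_step_square_integrable[OF j]])

lemma residual_measurable:
  assumes j: "1 \<le> j" "j \<le> J"
  shows "(\<lambda>p. residual j (fst p) (snd p)) \<in> borel_measurable (borel \<Otimes>\<^sub>M borel)"
proof -
  interpret G: prob_space "gaussian \<Delta> :: (real ^ 'm) measure" by (rule prob_space_gaussian[OF step_pos])
  have "(\<lambda>x. \<integral>w. after_step (J - j) x w * w $ i \<partial>gaussian \<Delta>) \<in> borel_measurable borel" for i
    by (intro G.borel_measurable_lebesgue_integral) (simp add: case_prod_beta)
  then have "(\<lambda>x. partial_deriv i (heat \<Delta> (after_step (J - j) x)) 0) \<in> borel_measurable borel" for i
    unfolding gradient_formula[OF j] by simp
  note [measurable] = this
  have [measurable]: "(\<lambda>x. heat \<Delta> (after_step (J - j) x) 0) \<in> borel_measurable borel"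
    unfolding u_Suc_heat[symmetric] by (rule u_measurable)
  show ?thesis
    unfolding residual_def by measurable
qed

definition residual_sum :: "real ^ 'd \<Rightarrow> nat \<Rightarrow> 'a \<Rightarrow> real" where
  "residual_sum x0 k \<omega> = (\<Sum>j=1..k. residual j (X 0 x0 (j - 1) \<omega>) (dW j \<omega>))"

text \<open>Conditionally on the past, the new summand has mean zero, so the mixed term of the square
  vanishes and the second moments add up.\<close>

lemma residual_sum_bound:
  assumes "k \<le> J"
  shows "residual_sum x0 k \<in> borel_measurable (\<F> k) \<and>
    (\<integral>\<^sup>+\<omega>. ennreal ((residual_sum x0 k \<omega>)\<^sup>2) \<partial>M) \<le> ennreal (real k * (B\<^sup>2 * l1_fourth_moment TYPE('m) * \<Delta>\<^sup>2))"
  using assms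
proof (induction k)
  case 0
  then show ?case by (simp add: residual_sum_def[abs_def])
next
  case (Suc k)
  have k: "1 \<le> Suc k" "Suc k \<le> J" using Suc by auto
  let ?S = "residual_sum x0" and ?R = "residual (Suc k)" and ?G = "gaussian \<Delta> :: (real ^ 'm) measure"
  interpret G: prob_space ?G by (rule prob_space_gaussian[OF step_pos])
  have S_Suc: "?S (Suc k) \<omega> = ?S k \<omega> + ?R (X 0 x0 k \<omega>) (dW (Suc k) \<omega>)" for \<omega>
    by (simp add: residual_sum_def)
  have S_meas: "?S k \<in> borel_measurable (\<F> k)" using Suc by simp
  have X_meas: "X 0 x0 k \<in> \<F> k \<rightarrow>\<^sub>M borel" using Suc by (intro euler_adapted) auto
  have Y: "(\<lambda>\<omega>. (?S k \<omega>, X 0 x0 k \<omega>)) \<in> \<F> k \<rightarrow>\<^sub>M borel \<Otimes>\<^sub>M borel"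
    by (rule measurable_Pair[OF S_meas X_meas])
  have sub: "subalgebra (\<F> (Suc k)) (\<F> k)" using Suc by (intro subalgebra_grid_mono) auto
  have "(\<lambda>\<omega>. (X 0 x0 k \<omega>, dW (Suc k) \<omega>)) \<in> \<F> (Suc k) \<rightarrow>\<^sub>M borel \<Otimes>\<^sub>M borel"
    by (rule measurable_Pair[OF measurable_from_subalg[OF sub X_meas] incr_adapted[OF k]])
  from measurable_compose[OF this residual_measurable[OF k]] measurable_from_subalg[OF sub S_meas]
  have meas: "?S (Suc k) \<in> borel_measurable (\<F> (Suc k))"
    unfolding S_Suc[abs_def] by simp
  let ?g = "\<lambda>p. ennreal ((fst (fst p) + ?R (snd (fst p)) (snd p))\<^sup>2)"
  have "(\<lambda>p. ?R (snd (fst p)) (snd p)) \<in> borel_measurable (((borel :: real measure) \<Otimes>\<^sub>M borel) \<Otimes>\<^sub>M borel)"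
    using measurable_compose[OF _ residual_measurable[OF k], of "\<lambda>p. (snd (fst p), snd p)" "((borel :: real measure) \<Otimes>\<^sub>M borel) \<Otimes>\<^sub>M borel"]
    by simp
  note [measurable] = this
  have g: "?g \<in> borel_measurable ((borel \<Otimes>\<^sub>M borel) \<Otimes>\<^sub>M borel)"
    by measurable
  have inner: "(\<integral>\<^sup>+w. ennreal ((s + ?R x w)\<^sup>2) \<partial>?G) \<le> ennreal (s\<^sup>2) + ennreal (B\<^sup>2 * l1_fourth_moment TYPE('m) * \<Delta>\<^sup>2)" for s x
  proof -
    have eq: "(s + ?R x w)\<^sup>2 = s\<^sup>2 + 2 * s * ?R x w + (?R x w)\<^sup>2" for w
      by (simp add: power2_sum)
    note int = residual_integrable[OF k, of x] residual_square_integrable[OF k, of x]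
    have "integrable ?G (\<lambda>w. (s + ?R x w)\<^sup>2)"
      unfolding eq using int by simp
    then have "(\<integral>\<^sup>+w. ennreal ((s + ?R x w)\<^sup>2) \<partial>?G) = ennreal (\<integral>w. (s + ?R x w)\<^sup>2 \<partial>?G)"
      by (intro nn_integral_eq_integral) auto
    also have "(\<integral>w. (s + ?R x w)\<^sup>2 \<partial>?G) = s\<^sup>2 + (\<integral>w. (?R x w)\<^sup>2 \<partial>?G)"
      unfolding eq using int by (simp add: residual_mean[OF k] G.prob_space[simplified])
    also have "ennreal \<dots> \<le> ennreal (s\<^sup>2 + B\<^sup>2 * l1_fourth_moment TYPE('m) * \<Delta>\<^sup>2)"
      using residual_variance[OF k, of x] by (intro ennreal_leI) simp
    also have "\<dots> = ennreal (s\<^sup>2) + ennreal (B\<^sup>2 * l1_fourth_moment TYPE('m) * \<Delta>\<^sup>2)"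
      using second_moment_const_nonneg by (intro ennreal_plus) auto
    finally show ?thesis .
  qed
  have ind: "indep_set (sets (\<F> k)) {dW (Suc k) -` A \<inter> space M | A. A \<in> sets borel}"
    using incr_gaussian_indep(2)[OF k] by simp
  have "(\<integral>\<^sup>+\<omega>. ennreal ((?S (Suc k) \<omega>)\<^sup>2) \<partial>M) = (\<integral>\<^sup>+\<omega>. ?g ((?S k \<omega>, X 0 x0 k \<omega>), dW (Suc k) \<omega>) \<partial>M)"
    by (simp add: S_Suc)
  also have "\<dots> = (\<integral>\<^sup>+\<omega>. \<integral>\<^sup>+w. ?g ((?S k \<omega>, X 0 x0 k \<omega>), w) \<partial>?G \<partial>M)"
    using Suc by (subst nn_integral_freezing[OF subalgebra_grid Y incr_measurable[OF k] ind g])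
      (simp_all add: incr_gaussian_indep(1)[OF k])
  also have "\<dots> \<le> (\<integral>\<^sup>+\<omega>. ennreal ((?S k \<omega>)\<^sup>2) + ennreal (B\<^sup>2 * l1_fourth_moment TYPE('m) * \<Delta>\<^sup>2) \<partial>M)"
    using inner by (intro nn_integral_mono) simp
  also have "\<dots> = (\<integral>\<^sup>+\<omega>. ennreal ((?S k \<omega>)\<^sup>2) \<partial>M) + ennreal (B\<^sup>2 * l1_fourth_moment TYPE('m) * \<Delta>\<^sup>2)"
    using measurable_from_subalg[OF subalgebra_grid S_meas] Suc
    by (subst nn_integral_add) (auto simp: emeasure_space_1)
  also have "\<dots> \<le> ennreal (real k * (B\<^sup>2 * l1_fourth_moment TYPE('m) * \<Delta>\<^sup>2)) + ennreal (B\<^sup>2 * l1_fourth_moment TYPE('m) * \<Delta>\<^sup>2)"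
    using Suc by (intro add_right_mono) auto
  also have "\<dots> = ennreal (real (Suc k) * (B\<^sup>2 * l1_fourth_moment TYPE('m) * \<Delta>\<^sup>2))"
  proof -
    have "0 \<le> B\<^sup>2 * l1_fourth_moment TYPE('m) * \<Delta>\<^sup>2"
      using second_moment_const_nonneg by simp
    then show ?thesis
      by (subst ennreal_plus[symmetric]) (simp_all add: distrib_right)
  qed
  finally show ?case using meas by simp
qed

lemma u_fun_grid:
  assumes j: "1 \<le> j" "j \<le> J"
  shows "u_fun T \<mu> \<sigma> f J (grid T J (j - 1)) x = heat \<Delta> (after_step (J - j) x)"
  using u_fun_heat[OF j step_pos order.refl, of x] grid_diff[OF j(1)] by (simp add: algebra_simps)

text \<open>The increments of \<open>u\<close> along the scheme telescope to \<open>f(X) - u(x\<^sub>0)\<close>.\<close>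

lemma M_int1_decomposition:
  "f (X 0 x0 J \<omega>) - M_int1 T \<mu> \<sigma> W f x0 J \<omega> = u J x0 + residual_sum x0 J \<omega>"
proof -
  have R: "residual j (X 0 x0 (j - 1) \<omega>) (dW j \<omega>) = (u (J - j) (X 0 x0 j \<omega>) - u (J - (j - 1)) (X 0 x0 (j - 1) \<omega>))
      - (\<Sum>i\<in>UNIV. partial_deriv i (u_fun T \<mu> \<sigma> f J (grid T J (j - 1)) (X 0 x0 (j - 1) \<omega>)) 0 * dW j \<omega> $ i)"
    if "j \<in> {1..J}" for j
  proof -
    have j: "1 \<le> j" "j \<le> J" using that by auto
    then have "J - (j - 1) = Suc (J - j)" by simp
    then show ?thesis
      using j after_step_euler[of 0 j "J - j" x0 \<omega>]
      unfolding u_fun_grid[OF j] by (simp add: residual_def u_Suc_heat del: u_back.simps One_nat_def)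
  qed
  have "residual_sum x0 J \<omega> = (\<Sum>j=1..J. (u (J - j) (X 0 x0 j \<omega>) - u (J - (j - 1)) (X 0 x0 (j - 1) \<omega>))
      - (\<Sum>i\<in>UNIV. partial_deriv i (u_fun T \<mu> \<sigma> f J (grid T J (j - 1)) (X 0 x0 (j - 1) \<omega>)) 0 * dW j \<omega> $ i))"
    unfolding residual_sum_def by (rule sum.cong[OF refl R])
  also have "\<dots> = (\<Sum>j=1..J. u (J - j) (X 0 x0 j \<omega>) - u (J - (j - 1)) (X 0 x0 (j - 1) \<omega>)) - M_int1 T \<mu> \<sigma> W f x0 J \<omega>"
    unfolding M_int1_def by (rule sum_subtractf)
  also have "(\<Sum>j=1..J. u (J - j) (X 0 x0 j \<omega>) - u (J - (j - 1)) (X 0 x0 (j - 1) \<omega>)) = u (J - J) (X 0 x0 J \<omega>) - u (J - 0) (X 0 x0 0 \<omega>)"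
    using sum_telescope''[of 0 J "\<lambda>j. u (J - j) (X 0 x0 j \<omega>)"] by simp
  finally show ?thesis by simp
qed

text \<open>Conditioning on the \<open>j\<close>-th grid point replaces \<open>f(X)\<close> by the function \<open>after_step\<close> of the
  increment; what remains is the right-hand side of Gaussian integration by parts.\<close>

lemma a_coeff_gradient:
  assumes j: "1 \<le> j" "j \<le> J"
  shows "a_coeff M F T \<mu> \<sigma> W f J j i x = sqrt \<Delta> * partial_deriv i (u_fun T \<mu> \<sigma> f J (grid T J (j - 1)) x) 0"
proof -
  interpret S: finite_measure_subalgebra M "\<F> j"
    by unfold_locales (rule subalgebra_grid[OF j(2)])
  let ?fX = "\<lambda>\<omega>. f (X (j - 1) x J \<omega>)" and ?c = "\<lambda>\<omega>. dW j \<omega> $ i / sqrt \<Delta>" and ?h = "after_step (J - j) x"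
  have j': "j - 1 < J" "J - j \<le> J - (j - 1)" "J - (J - j) = j" using j by auto
  have c: "?c \<in> borel_measurable (\<F> j)"
    using measurable_compose[OF incr_adapted[OF j] measurable_vec_nth] by simp
  have u_h: "u (J - j) (X (j - 1) x j \<omega>) = ?h (dW j \<omega>)" for \<omega>
    using after_step_euler[of "j - 1" j "J - j" x \<omega>] euler_start[of "j - 1" "j - 1" x \<omega>] j by simp
  have "AE \<omega> in M. real_cond_exp M (\<F> j) (\<lambda>\<omega>. ?c \<omega> * ?fX \<omega>) \<omega> = ?c \<omega> * real_cond_exp M (\<F> j) ?fX \<omega>"
    by (rule S.real_cond_exp_mult_measurable[OF c terminal_integrable[OF j'(1)]])
  moreover have "AE \<omega> in M. real_cond_exp M (\<F> j) ?fX \<omega> = ?h (dW j \<omega>)"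
    using cond_exp_terminal[OF j'(1,2), of x] unfolding j'(3) u_h by blast
  ultimately have AE: "AE \<omega> in M. real_cond_exp M (\<F> j) (\<lambda>\<omega>. ?fX \<omega> * ?c \<omega>) \<omega> = ?h (dW j \<omega>) * (dW j \<omega> $ i / sqrt \<Delta>)"
    by eventually_elim (simp add: mult.commute)
  note [measurable] = incr_measurable[OF j]
  have "a_coeff M F T \<mu> \<sigma> W f J j i x = (\<integral>\<omega>. ?h (dW j \<omega>) * (dW j \<omega> $ i / sqrt \<Delta>) \<partial>M)"
    unfolding a_coeff_def
    by (intro integral_cong_AE AE) (auto intro: measurable_from_subalg[OF S.subalg])
  also have "\<dots> = (\<integral>w. ?h w * (w $ i / sqrt \<Delta>) \<partial>distr M borel (dW j))"
    by (subst integral_distr) auto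
  also have "\<dots> = (\<integral>w. ?h w * w $ i / sqrt \<Delta> \<partial>gaussian \<Delta>)"
    by (simp add: incr_gaussian_indep(1)[OF j])
  also have "\<dots> = sqrt \<Delta> * ((\<integral>w. ?h w * w $ i \<partial>gaussian \<Delta>) / \<Delta>)"
    using step_pos by (simp add: field_simps)
  finally show ?thesis
    unfolding u_fun_grid[OF j] gradient_formula[OF j] .
qed

lemma M_ser1_eq_M_int1: "M_ser1 M F T \<mu> \<sigma> W f x0 J \<omega> = M_int1 T \<mu> \<sigma> W f x0 J \<omega>"
  unfolding M_ser1_def M_int1_def
  using step_pos by (intro sum.cong refl) (simp add: a_coeff_gradient)

lemma variance_bound:
  fixes x0 :: "real ^ 'd"
  defines "Z \<equiv> \<lambda>\<omega>. f (X 0 x0 J \<omega>) - M_int1 T \<mu> \<sigma> W f x0 J \<omega>"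
  shows "integrable M Z" and "integrable M (\<lambda>\<omega>. (Z \<omega>)\<^sup>2)" and "variance Z \<le> B\<^sup>2 * l1_fourth_moment TYPE('m) * T * \<Delta>"
proof -
  let ?S = "residual_sum x0 J"
  have Z: "Z = (\<lambda>\<omega>. u J x0 + ?S \<omega>)"
    unfolding Z_def by (simp add: M_int1_decomposition)
  note bound = residual_sum_bound[of J x0]
  have S_meas [measurable]: "?S \<in> borel_measurable M"
    using measurable_from_subalg[OF subalgebra_grid] bound by blast
  have S_sq: "integrable M (\<lambda>\<omega>. (?S \<omega>)\<^sup>2)"
    using bound by (intro integrableI_bounded) (auto intro: le_less_trans)
  have S_int: "integrable M ?S"
    by (rule square_integrable_imp_integrable[OF S_meas S_sq])
  show Z_int: "integrable M Z" using S_int by (simp add: Z)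
  show "integrable M (\<lambda>\<omega>. (Z \<omega>)\<^sup>2)"
    unfolding Z by (rule integrable_square_add) (use S_sq in auto)
  have "J * \<Delta> = T" using J_pos by (simp add: step_def)
  have "variance Z = variance ?S"
    using S_int by (simp add: Z prob_space)
  also have "\<dots> \<le> (\<integral>\<omega>. (?S \<omega>)\<^sup>2 \<partial>M)"
    using S_int S_sq by (subst variance_eq) auto
  also have "\<dots> \<le> real J * (B\<^sup>2 * l1_fourth_moment TYPE('m) * \<Delta>\<^sup>2)"
  proof -
    have "ennreal (\<integral>\<omega>. (?S \<omega>)\<^sup>2 \<partial>M) = (\<integral>\<^sup>+\<omega>. ennreal ((?S \<omega>)\<^sup>2) \<partial>M)"
      using S_sq by (intro nn_integral_eq_integral[symmetric]) auto
    also have "\<dots> \<le> ennreal (real J * (B\<^sup>2 * l1_fourth_moment TYPE('m) * \<Delta>\<^sup>2))" using bound by simp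
    finally show ?thesis
      using second_moment_const_nonneg by (subst (asm) ennreal_le_iff) auto
  qed
  also have "\<dots> = B\<^sup>2 * l1_fourth_moment TYPE('m) * (J * \<Delta>) * \<Delta>"
    by (simp add: power2_eq_square)
  finally show "variance Z \<le> B\<^sup>2 * l1_fourth_moment TYPE('m) * T * \<Delta>"
    unfolding \<open>J * \<Delta> = T\<close> .
qed

end

theorem theorem5:
  fixes M :: "'a measure" and F :: "real \<Rightarrow> 'a measure" and T :: real
    and W :: "real \<Rightarrow> 'a \<Rightarrow> real ^ 'm"
    and \<mu> :: "real ^ 'd \<Rightarrow> real ^ 'd" and \<sigma> :: "real ^ 'd \<Rightarrow> real ^ 'm ^ 'd"
    and x0 :: "real ^ 'd" and f :: "real ^ 'd \<Rightarrow> real"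
  assumes "T > 0"
    and "prob_space M" and "filtration_on M T F" and "brownian_motion M T F W"
    and "\<exists>L. L-lipschitz_on UNIV \<mu>" and "\<exists>L. L-lipschitz_on UNIV \<sigma>"
    and "f \<in> borel_measurable borel"
    and "Ass1 M T \<mu> \<sigma> W f" and "Ass2 3 M F T \<mu> \<sigma> W f"
    and "bounded_y_derivs T \<mu> \<sigma> f"
  shows "\<exists>c>0. \<forall>J\<ge>1.
    (let Z_int = (\<lambda>\<omega>. f (euler T \<mu> \<sigma> W J 0 x0 J \<omega>) - M_int1 T \<mu> \<sigma> W f x0 J \<omega>);
         Z_ser = (\<lambda>\<omega>. f (euler T \<mu> \<sigma> W J 0 x0 J \<omega>) - M_ser1 M F T \<mu> \<sigma> W f x0 J \<omega>)
     in integrable M Z_int \<and> integrable M (\<lambda>\<omega>. (Z_int \<omega>)\<^sup>2) \<and>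
        integrable M Z_ser \<and> integrable M (\<lambda>\<omega>. (Z_ser \<omega>)\<^sup>2) \<and>
        prob_space.variance M Z_int = prob_space.variance M Z_ser \<and>
        prob_space.variance M Z_int \<le> c * step T J)"
proof -
  obtain B where B: "\<And>J t x y i k l. J \<ge> 1 \<Longrightarrow> t \<in> {0..<T} \<Longrightarrow>
      partial_differentiable i (u_fun T \<mu> \<sigma> f J t x) y \<and>
      partial_differentiable k (partial_deriv i (u_fun T \<mu> \<sigma> f J t x)) y \<and>
      \<bar>partial_deriv k (partial_deriv i (u_fun T \<mu> \<sigma> f J t x)) y\<bar> \<le> B"
    using assms(10) unfolding bounded_y_derivs_def Let_def by metis
  have "\<mu> \<in> borel \<rightarrow>\<^sub>M borel" "\<sigma> \<in> borel \<rightarrow>\<^sub>M borel"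
    using assms(5,6) by (blast intro: borel_measurable_continuous_onI lipschitz_on_continuous_on)+
  moreover have "integrable M (\<lambda>\<omega>. f (euler T \<mu> \<sigma> W J j x J \<omega>))" if "j < J" for J j x
  proof -
    have "J \<ge> 1" "Suc j \<in> {1..J}" using that by auto
    then have "integrable M (\<lambda>\<omega>. f (euler T \<mu> \<sigma> W J (Suc j - 1) x J \<omega>))"
      using assms(8) unfolding Ass1_def by blast
    then show ?thesis by simp
  qed
  ultimately have smooth: "smooth_brownian_euler M F T W \<mu> \<sigma> f J B" if "J \<ge> 1" for J
    using assms B[OF that] that
    by (auto simp: smooth_brownian_euler_def smooth_brownian_euler_axioms_def brownian_euler_def brownian_euler_axioms_def)
  let ?K = "B\<^sup>2 * l1_fourth_moment TYPE('m) * T"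
  have K: "0 \<le> ?K"
    using smooth_brownian_euler.second_moment_const_nonneg[OF smooth[of 1]] assms(1) by simp
  show ?thesis
  proof (intro exI[of _ "?K + 1"] conjI allI impI)
    \<comment> \<open>The summand \<open>1\<close> only makes the constant positive when \<open>B = 0\<close>.\<close>
    show "0 < ?K + 1" using K by simp
    fix J :: nat assume J: "1 \<le> J"
    interpret smooth_brownian_euler M F T W \<mu> \<sigma> f J B by (rule smooth[OF J])
    have "?K * step T J \<le> (?K + 1) * step T J"
      using step_pos by simp
    then show "let Z_int = (\<lambda>\<omega>. f (euler T \<mu> \<sigma> W J 0 x0 J \<omega>) - M_int1 T \<mu> \<sigma> W f x0 J \<omega>);
         Z_ser = (\<lambda>\<omega>. f (euler T \<mu> \<sigma> W J 0 x0 J \<omega>) - M_ser1 M F T \<mu> \<sigma> W f x0 J \<omega>)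
     in integrable M Z_int \<and> integrable M (\<lambda>\<omega>. (Z_int \<omega>)\<^sup>2) \<and>
        integrable M Z_ser \<and> integrable M (\<lambda>\<omega>. (Z_ser \<omega>)\<^sup>2) \<and>
        variance Z_int = variance Z_ser \<and> variance Z_int \<le> (?K + 1) * step T J"
      using variance_bound[of x0] unfolding Let_def M_ser1_eq_M_int1 by linarith
  qed
qed

end
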